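(* Let $\{\mathbf e_n,\mathbf e_n^*\}_{n=1}^\infty$ be a complete, seminormalized biorthogonal system in the Banach space $\mathbb X$. If $\mathcal B=\{\mathbf e_n\}_{n=1}^\infty$ is almost greedy, or $\{\mathbf e_n,\mathbf e_n^*\}_{n=1}^\infty$ is bidemocratic, then $$\max\{K_N,\widetilde{\mathbf L}_N,\mathbf L_N,g_N^*,\mu_N^*,\widetilde{\mathbf L}_N^*,\mathbf L_N^*\}\ \lesssim\ \overline T_N(D,D^* )\ \lesssim\ \ln(N+1),\qquad N=1,2,\ldots$$
   Context: Setting: $(\mathbb X,\|\cdot\|)$ is a separable infinite-dimensional Banach space over $\mathbb K=\mathbb R$ or $\mathbb C$ with dual $(\mathbb X^*,\|\cdot\|_* )$. A system $\{\mathbf e_n,\mathbf e_n^*\}\subset\mathbb X\times\mathbb X^*$ is biorthogonal if $\mathbf e_n^*(\mathbf e_m)=\delta_{n,m}$; seminormalized if there are $A,B\in(0,\infty)$ with $A\le\|\mathbf e_n\|,\|\mathbf e_n^*\|_*\le B$ for all $n$; complete if the closed span of $\{\mathbf e_n\}$ is $\mathbb X$. $a_N\lesssim b_N$ means $a_N\le Cb_N$ for all $N$ with $C$ independent of $N$. A set $A$ with $|A|=N$ is a greedy set for $x$ of order $N$ if $\min_{n\in A}|\mathbf e_n^*(x)|\ge\max_{n\notin A}|\mathbf e_n^*(x)|$. A greedy operator of order $N$ is any map $G_Nx=\sum_{n\in A_x}\mathbf e_n^*(x)\mathbf e_n$ with $A_x$ a greedy set for $x$ of order $N$; $\mathcal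 G_N$ is the set of all of them, and $\|G_N\|=\sup_{x\ne0}\|G_Nx\|/\|x\|$. $\sigma_N(x)=\inf\{\|x-\sum_{n\in A}c_n\mathbf e_n\|:c_n\in\mathbb K,|A|\le N\}$, $\widetilde\sigma_N(x)=\inf\{\|x-\sum_{n\in A}\mathbf e_n^*(x)\mathbf e_n\|:|A|\le N\}$. $\mathbf L_N$ (resp. $\widetilde{\mathbf L}_N$) is the smallest constant with $\|x-G_Nx\|\le\mathbf L_N\sigma_N(x)$ (resp. $\le\widetilde{\mathbf L}_N\widetilde\sigma_N(x)$) for all $x\in\mathbb X$, $G_N\in\mathcal G_N$. $K_N=\sup_{|A|\le N}\|P_A\|$, $P_Ax=\sum_{n\in A}\mathbf e_n^*(x)\mathbf e_n$. $g_N=\sup_{n\le N}\|G_n\|$ (supremum also over all $G_n\in\mathcal G_n$). With $\mathbf 1_{\varepsilon A}=\sum_{j\in A}\varepsilon_j\mathbf e_j$, $\mathbf 1^*_{\varepsilon A}=\sum_{j\in A}\varepsilon_j\mathbf e^*_j$ ($|\varepsilon_j|=1$): $D(N)=\sup_{|A|=N,\varepsilon}\|\mathbf 1_{\varepsilon A}\|$, $d(N)=\inf_{|A|=N,\varepsilon}\|\mathbf 1_{\varepsilon A}\|$, $D^*(N)=\sup_{|A|=N,\varepsilon}\|\mathbf 1^*_{\varepsilon A}\|_*$, $d^*(N)=\inf_{|A|=N,\varepsilon}\|\mathbf 1^*_{\varepsilon A}\|_*$, $\mu_N=\sup_{n\le N}D(n)/d(n)$, $\mu_N^*=\sup_{n\le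 N}D^*(n)/d^*(n)$. Starred quantities $g_N^*,\mathbf L_N^*,\widetilde{\mathbf L}_N^*$ are the same quantities for the system $\{\mathbf e_n^*\}$ in $\widehat{\mathbb X}=\overline{\mathrm{span}}\{\mathbf e_n^*\}\subset\mathbb X^*$, with biorthogonal functionals $f\mapsto f(\mathbf e_n)$. $\overline T_N(D,D^* )=\min\{T_N(D,D^* ),T_N(D^*,D)\}$, where $T_N(\eta_1,\eta_2)=\sum_{j=1}^N\frac{\eta_1(j)}j(\eta_2(j)-\eta_2(j-1))$, $\eta_2(0)=0$. $\mathcal B$ is almost greedy if it is quasi-greedy ($\sup_Ng_N<\infty$) and democratic; equivalently, $\sup_N\widetilde{\mathbf L}_N<\infty$. The system is bidemocratic if there is $c$ with $D(N)D^*(N)\le cN$ for all $N$. *)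

theory Defs
  imports "HOL-Analysis.Analysis"
begin

(* The scalar field is the real or the complex numbers; stated as a class, so that
   one theorem covers both.  The norm is automatically the usual absolute value,
   because the norm of a real_normed_field is multiplicative. *)

class real_or_complex = real_normed_field +
  assumes real_or_complex:
    "(\<forall>z. \<exists>a. z = scaleR a 1) \<or>
     (\<exists>i. i * i = - 1 \<and> (\<forall>z. \<exists>a b. z = scaleR a 1 + scaleR b i))"

instance real :: real_or_complex
  by standard simp

instance complex :: real_or_complex
proof
  have "\<i> * \<i> = -1 \<and> (\<forall>z. \<exists>a b. z = a *\<^sub>R 1 + b *\<^sub>R \<i>)"
    by (auto simp: complex_eq_iff)
  then show "(\<forall>z::complex. \<exists>a. z = a *\<^sub>R 1) \<or>
    (\<exists>i::complex. i * i = - 1 \<and> (\<forall>z. \<exists>a b. z = a *\<^sub>R 1 + b *\<^sub>R i))"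
    by blast
qed

(* A normed space over the scalar field 'k: the underlying real normed space is given
   by the type, the 'k-multiplication extends the real one and the norm is
   absolutely homogeneous for it. *)

locale scalar_normed_space = vector_space scal
  for scal :: "'k::real_or_complex \<Rightarrow> 'a::real_normed_vector \<Rightarrow> 'a" +
  assumes norm_scal: "norm (scal c x) = norm c * norm x"
    and scal_of_real: "scal (of_real r) x = r *\<^sub>R x"

definition infinite_dimensional :: "('k::real_or_complex \<Rightarrow> 'a::real_normed_vector \<Rightarrow> 'a) \<Rightarrow> bool"
  where "infinite_dimensional scal \<longleftrightarrow> \<not> (\<exists>B. finite B \<and> module.span scal B = UNIV)"

(* The dual consists of the 'k-linear functionals among the bounded real-linear maps;
   the norm of the type of bounded linear functions is the operator norm. *)

definition dual_space ::
    "('k::real_or_complex \<Rightarrow> 'a::real_normed_vector \<Rightarrow> 'a) \<Rightarrow> ('a \<Rightarrow>\<^sub>L 'k) set"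
  where "dual_space scal = {f. \<forall>c x. blinfun_apply f (scal c x) = c * blinfun_apply f x}"

definition dual_scal :: "'k::real_or_complex \<Rightarrow> ('a::real_normed_vector \<Rightarrow>\<^sub>L 'k) \<Rightarrow> ('a \<Rightarrow>\<^sub>L 'k)"
  where "dual_scal c f = Blinfun (\<lambda>x. c * blinfun_apply f x)"

lemma dual_scal_apply [simp]: "blinfun_apply (dual_scal c f) x = c * blinfun_apply f x"
  unfolding dual_scal_def
  by (subst bounded_linear_Blinfun_apply)
     (auto intro!: bounded_linear_const_mult blinfun.bounded_linear_right)


(* Index sets start at 0: the vector with index n here is the (n+1)-st one.  All
   notions below are invariant under relabelling of the index set. *)

definition biorthogonal :: "(nat \<Rightarrow> 'a::real_normed_vector) \<Rightarrow> (nat \<Rightarrow> 'a \<Rightarrow>\<^sub>L 'k::real_or_complex) \<Rightarrow> bool"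
  where "biorthogonal e es \<longleftrightarrow> (\<forall>n m. blinfun_apply (es n) (e m) = (if n = m then 1 else 0))"

definition seminormalized :: "(nat \<Rightarrow> 'a::real_normed_vector) \<Rightarrow> (nat \<Rightarrow> 'a \<Rightarrow>\<^sub>L 'k::real_or_complex) \<Rightarrow> bool"
  where "seminormalized e es \<longleftrightarrow>
    (\<exists>A B. 0 < A \<and> 0 < B \<and>
      (\<forall>n. A \<le> norm (e n) \<and> norm (e n) \<le> B \<and> A \<le> norm (es n) \<and> norm (es n) \<le> B))"

definition complete_system ::
    "('k::real_or_complex \<Rightarrow> 'a::real_normed_vector \<Rightarrow> 'a) \<Rightarrow> (nat \<Rightarrow> 'a) \<Rightarrow> bool"
  where "complete_system scal e \<longleftrightarrow> closure (module.span scal (range e)) = UNIV"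

(* The greedy-type quantities are needed both for the given system in the whole space
   and for the dual system in a proper subspace of the dual, so they are defined
   relative to a carrier set spc. *)

record ('k, 'a) bsystem =
  spc :: "'a set"
  scl :: "'k \<Rightarrow> 'a \<Rightarrow> 'a"
  vec :: "nat \<Rightarrow> 'a"
  coef :: "nat \<Rightarrow> 'a \<Rightarrow> 'k"

definition primal_system ::
    "('k::real_or_complex \<Rightarrow> 'a::real_normed_vector \<Rightarrow> 'a) \<Rightarrow> (nat \<Rightarrow> 'a) \<Rightarrow> (nat \<Rightarrow> 'a \<Rightarrow>\<^sub>L 'k) \<Rightarrow> ('k, 'a) bsystem"
  where "primal_system scal e es =
    \<lparr>spc = UNIV, scl = scal, vec = e, coef = (\<lambda>n x. blinfun_apply (es n) x)\<rparr>"

definition dual_system ::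
    "(nat \<Rightarrow> 'a::real_normed_vector) \<Rightarrow> (nat \<Rightarrow> 'a \<Rightarrow>\<^sub>L 'k::real_or_complex) \<Rightarrow> ('k, 'a \<Rightarrow>\<^sub>L 'k) bsystem"
  where "dual_system e es =
    \<lparr>spc = closure (module.span dual_scal (range es)), scl = dual_scal, vec = es,
     coef = (\<lambda>n f. blinfun_apply f (e n))\<rparr>"

definition proj :: "('k::real_or_complex, 'a::real_normed_vector) bsystem \<Rightarrow> nat set \<Rightarrow> 'a \<Rightarrow> 'a"
  where "proj S A x = (\<Sum>n\<in>A. scl S (coef S n x) (vec S n))"

(* Suprema that could a priori be infinite are taken in the extended reals. *)

definition op_norm :: "('k::real_or_complex, 'a::real_normed_vector) bsystem \<Rightarrow> ('a \<Rightarrow> 'a) \<Rightarrow> ereal"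
  where "op_norm S T = (SUP x\<in>{x \<in> spc S. x \<noteq> 0}. ereal (norm (T x) / norm x))"

definition greedy_set :: "('k::real_or_complex, 'a::real_normed_vector) bsystem \<Rightarrow> nat \<Rightarrow> 'a \<Rightarrow> nat set \<Rightarrow> bool"
  where "greedy_set S N x A \<longleftrightarrow> finite A \<and> card A = N \<and>
    (\<forall>n\<in>A. \<forall>m. m \<notin> A \<longrightarrow> norm (coef S m x) \<le> norm (coef S n x))"

definition greedy_ops :: "('k::real_or_complex, 'a::real_normed_vector) bsystem \<Rightarrow> nat \<Rightarrow> ('a \<Rightarrow> 'a) set"
  where "greedy_ops S N = {G. \<forall>x\<in>spc S. \<exists>A. greedy_set S N x A \<and> G x = proj S A x}"

definition sigma :: "('k::real_or_complex, 'a::real_normed_vector) bsystem \<Rightarrow> nat \<Rightarrow> 'a \<Rightarrow> real"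
  where "sigma S N x =
    Inf {norm (x - (\<Sum>n\<in>A. scl S (c n) (vec S n))) | A c. finite A \<and> card A \<le> N}"

definition sigma_tilde :: "('k::real_or_complex, 'a::real_normed_vector) bsystem \<Rightarrow> nat \<Rightarrow> 'a \<Rightarrow> real"
  where "sigma_tilde S N x = Inf {norm (x - proj S A x) | A. finite A \<and> card A \<le> N}"

definition Leb :: "('k::real_or_complex, 'a::real_normed_vector) bsystem \<Rightarrow> nat \<Rightarrow> ereal"
  where "Leb S N = Inf {ereal C | C.
    \<forall>x\<in>spc S. \<forall>G\<in>greedy_ops S N. norm (x - G x) \<le> C * sigma S N x}"

definition Leb_tilde :: "('k::real_or_complex, 'a::real_normed_vector) bsystem \<Rightarrow> nat \<Rightarrow> ereal"
  where "Leb_tilde S N = Inf {ereal C | C.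
    \<forall>x\<in>spc S. \<forall>G\<in>greedy_ops S N. norm (x - G x) \<le> C * sigma_tilde S N x}"

definition K_par :: "('k::real_or_complex, 'a::real_normed_vector) bsystem \<Rightarrow> nat \<Rightarrow> ereal"
  where "K_par S N = (SUP A\<in>{A. finite A \<and> card A \<le> N}. op_norm S (proj S A))"

definition g_par :: "('k::real_or_complex, 'a::real_normed_vector) bsystem \<Rightarrow> nat \<Rightarrow> ereal"
  where "g_par S N = (SUP n\<in>{1..N}. SUP G\<in>greedy_ops S n. op_norm S G)"

definition signed_sum :: "('k::real_or_complex, 'a::real_normed_vector) bsystem \<Rightarrow> (nat \<Rightarrow> 'k) \<Rightarrow> nat set \<Rightarrow> 'a"
  where "signed_sum S \<epsilon> A = (\<Sum>j\<in>A. scl S (\<epsilon> j) (vec S j))"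

definition signed_norms :: "('k::real_or_complex, 'a::real_normed_vector) bsystem \<Rightarrow> nat \<Rightarrow> ereal set"
  where "signed_norms S N =
    {ereal (norm (signed_sum S \<epsilon> A)) | \<epsilon> A. finite A \<and> card A = N \<and> (\<forall>j\<in>A. norm (\<epsilon> j) = 1)}"

(* Upper and lower fundamental functions; applied to the dual system they are the
   starred functions, the norm of the dual system being the dual norm. *)

definition D_up :: "('k::real_or_complex, 'a::real_normed_vector) bsystem \<Rightarrow> nat \<Rightarrow> ereal"
  where "D_up S N = Sup (signed_norms S N)"

definition d_low :: "('k::real_or_complex, 'a::real_normed_vector) bsystem \<Rightarrow> nat \<Rightarrow> ereal"
  where "d_low S N = Inf (signed_norms S N)"

definition mu :: "('k::real_or_complex, 'a::real_normed_vector) bsystem \<Rightarrow> nat \<Rightarrow> ereal"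
  where "mu S N = (SUP n\<in>{1..N}. D_up S n / d_low S n)"

definition T_sum :: "(nat \<Rightarrow> ereal) \<Rightarrow> (nat \<Rightarrow> ereal) \<Rightarrow> nat \<Rightarrow> ereal"
  where "T_sum \<eta>1 \<eta>2 N =
    (\<Sum>j=1..N. \<eta>1 j / ereal (real j) * (\<eta>2 j - (if j = 1 then 0 else \<eta>2 (j - 1))))"

definition T_bar :: "(nat \<Rightarrow> ereal) \<Rightarrow> (nat \<Rightarrow> ereal) \<Rightarrow> nat \<Rightarrow> ereal"
  where "T_bar \<eta>1 \<eta>2 N = min (T_sum \<eta>1 \<eta>2 N) (T_sum \<eta>2 \<eta>1 N)"

definition quasi_greedy :: "('k::real_or_complex, 'a::real_normed_vector) bsystem \<Rightarrow> bool"
  where "quasi_greedy S \<longleftrightarrow> (SUP N\<in>{1..}. g_par S N) < \<infinity>"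

definition democratic :: "('k::real_or_complex, 'a::real_normed_vector) bsystem \<Rightarrow> bool"
  where "democratic S \<longleftrightarrow>
    (\<exists>C. \<forall>A B. finite A \<and> finite B \<and> card A = card B \<longrightarrow>
       norm (signed_sum S (\<lambda>_. 1) A) \<le> C * norm (signed_sum S (\<lambda>_. 1) B))"

definition almost_greedy :: "('k::real_or_complex, 'a::real_normed_vector) bsystem \<Rightarrow> bool"
  where "almost_greedy S \<longleftrightarrow> quasi_greedy S \<and> democratic S"

definition bidemocratic ::
    "('k::real_or_complex, 'a::real_normed_vector) bsystem \<Rightarrow> ('k, 'b::real_normed_vector) bsystem \<Rightarrow> bool"
  where "bidemocratic S S' \<longleftrightarrow> (\<exists>c::real. \<forall>N\<ge>1. D_up S N * D_up S' N \<le> ereal (c * real N))"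

definition lesssim :: "(nat \<Rightarrow> ereal) \<Rightarrow> (nat \<Rightarrow> ereal) \<Rightarrow> bool"  (infix "\<lesssim>" 50)
  where "a \<lesssim> b \<longleftrightarrow> (\<exists>C::real. C > 0 \<and> (\<forall>N\<ge>1. a N \<le> ereal C * b N))"

end

theory Submission
  imports Defs
begin

text \<open>
  Write \<open>T(\<eta>, \<theta>)\<close> for the sum \<open>\<Sum>j \<le> N. \<eta>(j)/j (\<theta>(j) - \<theta>(j-1))\<close>, and let
  \<open>a\<^sub>1 \<ge> a\<^sub>2 \<ge> \<dots>\<close> be the decreasing rearrangement of the coefficients of \<open>x\<close> on a set
  \<open>A\<close> with at most \<open>N\<close> elements.  Duality gives \<open>a\<^sub>1 + \<dots> + a\<^sub>j \<le> D*(j) \<parallel>x\<parallel>\<close>, and summation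
  by parts bounds \<open>\<parallel>P\<^sub>A x\<parallel>\<close> by \<open>\<Sum> a\<^sub>j r\<^sub>j\<close> for every \<open>r\<close> whose partial sums dominate \<open>D\<close>.
  Taking \<open>r\<^sub>j = D(j) - D(j-1)\<close> and \<open>a\<^sub>j \<le> D*(j) \<parallel>x\<parallel> / j\<close> gives \<open>T(D*, D) \<parallel>x\<parallel>\<close>; taking the
  decreasing sequence \<open>r\<^sub>j = D(j)/j\<close> and summing by parts once more gives \<open>T(D, D*) \<parallel>x\<parallel>\<close>.
  The same argument applies to the dual system.  The other parameters are controlled by these
  projection bounds together with \<open>D(k) D*(k)/k \<le> T\<close>, which holds because \<open>D(j)/j\<close> and
  \<open>D*(j)/j\<close> decrease.

  For the logarithmic bound, both alternatives imply \<open>D*(n) \<le> C \<Sum>j \<le> n. 1/D(j)\<close>: in the almost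
  greedy case because the \<open>j\<close>-th largest coefficient of \<open>x\<close> is at most a multiple of
  \<open>\<parallel>x\<parallel>/D(j)\<close>.  Summing \<open>T(D, D*)\<close> by parts then turns it into a multiple of \<open>\<Sum> 1/j\<close>.
\<close>

section \<open>Decreasing rearrangement and summation by parts\<close>

lemma ex_decreasing_enumeration:
  fixes h :: "'b \<Rightarrow> real"
  assumes "finite A"
  obtains f where "bij_betw f {..<card A} A"
    and "\<And>i j. i \<le> j \<Longrightarrow> j < card A \<Longrightarrow> h (f j) \<le> h (f i)"
proof -
  obtain ys where ys: "set ys = A" "distinct ys"
    using finite_distinct_list[OF assms] by blast
  define xs where "xs = sort_key (\<lambda>a. - h a) ys"
  have xs: "set xs = A" "distinct xs" "sorted (map (\<lambda>a. - h a) xs)"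
    using ys by (simp_all add: xs_def)
  then have len: "length xs = card A"
    by (metis distinct_card)
  show thesis
  proof
    show "bij_betw ((!) xs) {..<card A} A"
      using bij_betw_nth[OF xs(2)] xs(1) len by simp
    show "h (xs ! j) \<le> h (xs ! i)" if "i \<le> j" "j < card A" for i j
      using sorted_nth_mono[OF xs(3) that(1)] that len by simp
  qed
qed

text \<open>Nonnegative decreasing weights are nonnegative combinations of indicators of initial
  segments, so only the partial sums of \<open>v\<close> matter. The terms of \<open>r\<close> may
  have any sign.\<close>

lemma norm_sum_decreasing_weights_le:
  fixes v :: "nat \<Rightarrow> 'b::real_normed_vector"
  assumes part: "\<And>n. n \<le> N \<Longrightarrow> norm (\<Sum>j<n. v j) \<le> (\<Sum>j<n. r j)"
    and anti: "\<And>i j. i \<le> j \<Longrightarrow> j < N \<Longrightarrow> b j \<le> b i"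
    and nonneg: "\<And>j. j < N \<Longrightarrow> 0 \<le> b j"
  shows "norm (\<Sum>j<N. b j *\<^sub>R v j) \<le> (\<Sum>j<N. b j * r j)"
proof -
  \<comment> \<open>The shift \<open>t\<close> strengthens the induction: the induction hypothesis
    is used with \<open>t = b n\<close>, which annihilates the last weight, and what remains is a
    multiple of a single partial sum.\<close>
  have "norm (\<Sum>j<n. (b j - t) *\<^sub>R v j) \<le> (\<Sum>j<n. (b j - t) * r j)"
    if "n \<le> N" "\<And>j. j < n \<Longrightarrow> t \<le> b j" for n t
    using that
  proof (induction n arbitrary: t)
    case 0
    then show ?case by simp
  next
    case (Suc n)
    have split_v: "(\<Sum>j<Suc n. (b j - t) *\<^sub>R v j) =
        (\<Sum>j<n. (b j - b n) *\<^sub>R v j) + (b n - t) *\<^sub>R (\<Sum>j<Suc n. v j)"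
      by (simp add: scaleR_sum_right scaleR_add_right sum.distrib[symmetric]
          scaleR_add_left[symmetric])
    have split_r: "(\<Sum>j<Suc n. (b j - t) * r j) =
        (\<Sum>j<n. (b j - b n) * r j) + (b n - t) * (\<Sum>j<Suc n. r j)"
      by (simp add: sum_distrib_left distrib_left sum.distrib[symmetric] distrib_right[symmetric])
    have "norm (\<Sum>j<n. (b j - b n) *\<^sub>R v j) \<le> (\<Sum>j<n. (b j - b n) * r j)"
      using Suc.prems anti by (intro Suc.IH) auto
    moreover have "norm ((b n - t) *\<^sub>R (\<Sum>j<Suc n. v j)) \<le> (b n - t) * (\<Sum>j<Suc n. r j)"
      using part[OF Suc.prems(1)] Suc.prems(2)[of n] by (simp add: mult_left_mono)
    ultimately show ?case
      unfolding split_v split_r by (meson add_mono norm_triangle_le)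
  qed
  from this[of N 0] nonneg show ?thesis by simp
qed

lemma norm_sum_decreasing_weights_le_const:
  fixes v :: "nat \<Rightarrow> 'b::real_normed_vector"
  assumes part: "\<And>n. n \<le> N \<Longrightarrow> norm (\<Sum>j<n. v j) \<le> K"
    and anti: "\<And>i j. i \<le> j \<Longrightarrow> j < N \<Longrightarrow> b j \<le> b i"
    and nonneg: "\<And>j. j < N \<Longrightarrow> 0 \<le> b j"
    and le: "\<And>j. j < N \<Longrightarrow> b j \<le> M" and "0 \<le> M"
  shows "norm (\<Sum>j<N. b j *\<^sub>R v j) \<le> M * K"
proof -
  \<comment> \<open>All the mass sits at index 0, so every nonempty partial sum of \<open>r\<close>
    equals \<open>K\<close>.\<close>
  define r where "r j = (if j = 0 then K else 0)" for j :: nat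
  have K: "0 \<le> K"
    using part[of 0] by simp
  have sum_r: "(\<Sum>j<n. g j * r j) = (if n = 0 then 0 else g 0 * K)" for n and g :: "nat \<Rightarrow> real"
  proof -
    have "(\<Sum>j<n. g j * r j) = (\<Sum>j<n. if j = 0 then g 0 * K else 0)"
      by (intro sum.cong) (auto simp: r_def)
    then show ?thesis by simp
  qed
  have "norm (\<Sum>j<N. b j *\<^sub>R v j) \<le> (\<Sum>j<N. b j * r j)"
    using part sum_r[of "\<lambda>_. 1"] anti nonneg by (intro norm_sum_decreasing_weights_le) auto
  also have "\<dots> \<le> M * K"
    unfolding sum_r using le[of 0] K \<open>0 \<le> M\<close> by (auto intro: mult_right_mono)
  finally show ?thesis .
qed

section \<open>Fundamental functions and the sums T\<close>

text \<open>Real-valued counterpart of \<open>T_sum\<close>, with the index shifted by one so that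
  \<open>\<theta> 0\<close> takes the place of the special case at the first term.\<close>

definition tsum :: "(nat \<Rightarrow> real) \<Rightarrow> (nat \<Rightarrow> real) \<Rightarrow> nat \<Rightarrow> real"
  where "tsum \<eta> \<theta> N = (\<Sum>j<N. \<eta> (Suc j) / real (Suc j) * (\<theta> (Suc j) - \<theta> j))"

text \<open>Ratios are compared only at positive arguments: at 0 division would give the value 0 and
  spoil the monotonicity.\<close>

definition fundamental :: "(nat \<Rightarrow> real) \<Rightarrow> bool"
  where "fundamental \<eta> \<longleftrightarrow> \<eta> 0 = 0 \<and> mono \<eta> \<and>
    (\<forall>i j. i \<le> j \<longrightarrow> \<eta> (Suc j) / real (Suc j) \<le> \<eta> (Suc i) / real (Suc i))"

lemma fundamentalD:
  assumes "fundamental \<eta>"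
  shows "\<eta> 0 = 0" and "i \<le> j \<Longrightarrow> \<eta> i \<le> \<eta> j" and "0 \<le> \<eta> i"
    and "i \<le> j \<Longrightarrow> \<eta> (Suc j) / real (Suc j) \<le> \<eta> (Suc i) / real (Suc i)"
  using assms unfolding fundamental_def mono_def by (auto, metis le0)

text \<open>Each of the \<open>n\<close> ratios is at least \<open>\<eta> n / n\<close>. This makes
  the ratios an admissible dominating sequence in the summation by parts.\<close>

lemma fundamental_le_sum_ratios:
  assumes "fundamental \<eta>"
  shows "\<eta> n \<le> (\<Sum>j<n. \<eta> (Suc j) / real (Suc j))"
proof (cases n)
  case 0
  then show ?thesis using fundamentalD(1)[OF assms] by simp
next
  case (Suc k)
  have "(\<Sum>j<n. \<eta> (Suc k) / real (Suc k)) \<le> (\<Sum>j<n. \<eta> (Suc j) / real (Suc j))"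
    using Suc by (intro sum_mono fundamentalD(4)[OF assms]) auto
  then show ?thesis using Suc by simp
qed

lemma tsum_mono:
  assumes "fundamental \<eta>" "fundamental \<theta>" "m \<le> n"
  shows "tsum \<eta> \<theta> m \<le> tsum \<eta> \<theta> n"
  unfolding tsum_def
  using assms(3) fundamentalD(3)[OF assms(1)] fundamentalD(2)[OF assms(2)]
  by (intro sum_mono2) (auto intro!: mult_nonneg_nonneg)

text \<open>Among the first \<open>k\<close> terms every ratio of \<open>\<eta>\<close> is at least
  the last one, and the increments of \<open>\<theta>\<close> telescope to
  \<open>\<theta> k\<close>.\<close>

lemma product_ratio_le_tsum:
  assumes "fundamental \<eta>" "fundamental \<theta>" "0 < k" "k \<le> N"
  shows "\<eta> k * \<theta> k / real k \<le> tsum \<eta> \<theta> N"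
proof -
  obtain m where m: "k = Suc m"
    using assms(3) gr0_implies_Suc by blast
  have "\<eta> k * \<theta> k / real k = \<eta> k / real k * (\<Sum>j<k. \<theta> (Suc j) - \<theta> j)"
    using fundamentalD(1)[OF assms(2)] by (simp add: sum_lessThan_telescope)
  also have "\<dots> \<le> tsum \<eta> \<theta> k"
    unfolding tsum_def sum_distrib_left m
    using fundamentalD(2)[OF assms(2)] fundamentalD(4)[OF assms(1)]
    by (intro sum_mono mult_right_mono) (auto simp del: of_nat_Suc)
  also have "\<dots> \<le> tsum \<eta> \<theta> N"
    by (intro tsum_mono assms)
  finally show ?thesis .
qed

lemma harmonic_sum_le_ln: "(\<Sum>j<N. 1 / real (Suc j)) \<le> 2 * ln (real N + 1)"
proof (induction N)
  case 0
  then show ?case by simp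
next
  case (Suc N)
  have "ln (real N + 1) - ln (real N + 2) \<le> ((real N + 1) - (real N + 2)) / (real N + 2)"
    by (intro ln_diff_le) auto
  \<comment> \<open>The logarithm grows by at least \<open>1 / (N + 2)\<close> per step, not
    \<open>1 / (N + 1)\<close>; the factor 2 pays for the difference.\<close>
  moreover have "1 / real (Suc N) \<le> 2 / (real N + 2)"
    by (simp add: field_simps)
  ultimately show ?case
    using Suc by (simp add: diff_divide_distrib add.commute)
qed

text \<open>Since the weights \<open>\<eta> j / j\<close> decrease, the increments of
  \<open>\<theta>\<close> may be exchanged for \<open>C / \<eta> j\<close>, whose partial sums
  dominate. The values of \<open>\<eta>\<close> cancel and a harmonic sum is left.\<close>

lemma tsum_le_ln:
  assumes \<eta>: "fundamental \<eta>" and \<theta>: "fundamental \<theta>" and pos: "0 < \<eta> 1"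
    and le: "\<And>n. \<theta> n \<le> C * (\<Sum>j<n. 1 / \<eta> (Suc j))" and "0 \<le> C"
  shows "tsum \<eta> \<theta> N \<le> 2 * C * ln (real N + 1)"
proof -
  have pos': "0 < \<eta> (Suc j)" for j
    using fundamentalD(2)[OF \<eta>, of 1 "Suc j"] pos by simp
  have "norm (\<Sum>j<N. (\<eta> (Suc j) / real (Suc j)) *\<^sub>R (\<theta> (Suc j) - \<theta> j))
      \<le> (\<Sum>j<N. \<eta> (Suc j) / real (Suc j) * (C / \<eta> (Suc j)))"
  proof (rule norm_sum_decreasing_weights_le)
    show "norm (\<Sum>j<n. \<theta> (Suc j) - \<theta> j) \<le> (\<Sum>j<n. C / \<eta> (Suc j))" for n
      using le[of n] fundamentalD(1,3)[OF \<theta>]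
      by (simp add: sum_lessThan_telescope sum_distrib_left)
  qed (use fundamentalD(3,4)[OF \<eta>] in \<open>auto simp del: of_nat_Suc\<close>)
  also have "\<dots> = C * (\<Sum>j<N. 1 / real (Suc j))"
    unfolding sum_distrib_left using pos' by (intro sum.cong) (auto simp: less_imp_neq[symmetric])
  also have "\<dots> \<le> C * (2 * ln (real N + 1))"
    by (intro mult_left_mono harmonic_sum_le_ln assms)
  finally show ?thesis by (simp add: tsum_def)
qed

section \<open>Biorthogonal systems: coefficients, projections, greedy sets\<close>

text \<open>The coefficients are linear on the whole type and not merely on \<open>spc S\<close>,
  which holds for the given system and for its dual alike.\<close>

locale biorthogonal_bsystem = scalar_normed_space "scl S"
  for S :: "('k::real_or_complex, 'a::real_normed_vector) bsystem" +
  assumes coef_add: "coef S n (x + y) = coef S n x + coef S n y"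
    and coef_scale: "coef S n (scl S c x) = c * coef S n x"
    and coef_vec: "coef S n (vec S m) = (if n = m then 1 else 0)"
begin

lemma scale_real_mult: "scl S (of_real r * c) x = r *\<^sub>R scl S c x"
  by (metis scale_scale scal_of_real)

lemma coef_zero [simp]: "coef S n 0 = 0"
  using coef_add[of n 0 0] by simp

lemma coef_diff: "coef S n (x - y) = coef S n x - coef S n y"
  using coef_add[of n "x - y" y] by simp

lemma coef_sum: "coef S n (sum f A) = (\<Sum>a\<in>A. coef S n (f a))"
  by (induction A rule: infinite_finite_induct) (auto simp: coef_add)

lemma coef_combination:
  assumes "finite A"
  shows "coef S n (\<Sum>m\<in>A. scl S (c m) (vec S m)) = (if n \<in> A then c n else 0)"
proof -
  have "coef S n (\<Sum>m\<in>A. scl S (c m) (vec S m)) = (\<Sum>m\<in>A. if n = m then c m else 0)"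
    unfolding coef_sum by (intro sum.cong) (auto simp: coef_scale coef_vec)
  then show ?thesis using assms by simp
qed

lemma proj_diff: "proj S A (x - y) = proj S A x - proj S A y"
  unfolding proj_def by (simp add: coef_diff scale_left_diff_distrib sum_subtractf)

lemma proj_union_disjoint:
  "finite A \<Longrightarrow> finite B \<Longrightarrow> A \<inter> B = {} \<Longrightarrow> proj S (A \<union> B) x = proj S A x + proj S B x"
  unfolding proj_def by (rule sum.union_disjoint)

lemma proj_combination:
  assumes "finite A" "B \<subseteq> A"
  shows "proj S A (\<Sum>n\<in>B. scl S (c n) (vec S n)) = (\<Sum>n\<in>B. scl S (c n) (vec S n))"
proof -
  have "proj S A (\<Sum>n\<in>B. scl S (c n) (vec S n)) =
      (\<Sum>n\<in>A. scl S (if n \<in> B then c n else 0) (vec S n))"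
    unfolding proj_def using assms by (simp add: coef_combination finite_subset)
  also have "\<dots> = (\<Sum>n\<in>B. scl S (if n \<in> B then c n else 0) (vec S n))"
    using assms by (intro sum.mono_neutral_right) auto
  finally show ?thesis by simp
qed

text \<open>Greedy sets grow by one index at a time: a remaining index with the largest coefficient
  is added. Coefficients tending to zero make that maximum attained.\<close>

lemma ex_greedy_set:
  assumes c0: "\<And>\<delta>. 0 < \<delta> \<Longrightarrow> finite {n. \<delta> \<le> norm (coef S n x)}"
  shows "\<exists>A. greedy_set S N x A"
proof (induction N)
  case 0
  show ?case by (rule exI[of _ "{}"]) (simp add: greedy_set_def)
next
  case (Suc N)
  then obtain A where A: "finite A" "card A = N"
    "\<And>n m. n \<in> A \<Longrightarrow> m \<notin> A \<Longrightarrow> norm (coef S m x) \<le> norm (coef S n x)"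
    by (auto simp: greedy_set_def)
  have "\<exists>k. k \<notin> A \<and> (\<forall>m. m \<notin> A \<longrightarrow> norm (coef S m x) \<le> norm (coef S k x))"
  proof (cases "\<exists>m. m \<notin> A \<and> coef S m x \<noteq> 0")
    case True
    then obtain m where m: "m \<notin> A" "coef S m x \<noteq> 0" by blast
    \<comment> \<open>The maximum over an infinite complement is reduced to the finitely many
      indices that are at least as large as one fixed nonzero coefficient.\<close>
    let ?F = "{n. norm (coef S m x) \<le> norm (coef S n x)} - A"
    have F: "finite ?F" "?F \<noteq> {}"
      using c0[of "norm (coef S m x)"] m by auto
    obtain k where k: "k \<in> ?F" "norm (coef S k x) = Max ((\<lambda>n. norm (coef S n x)) ` ?F)"
      using Max_in[of "(\<lambda>n. norm (coef S n x)) ` ?F"] F by fastforce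
    have le: "norm (coef S n x) \<le> norm (coef S k x)" if "n \<in> ?F" for n
      unfolding k(2) using that F(1) by (intro Max_ge) auto
    have "norm (coef S n x) \<le> norm (coef S k x)" if "n \<notin> A" for n
      using le[of n] le[of m] k(1) m that by (cases "n \<in> ?F") auto
    then show ?thesis using k(1) by auto
  next
    case False
    moreover obtain k where "k \<notin> A"
      using A(1) ex_new_if_finite infinite_UNIV_nat by blast
    ultimately show ?thesis by (intro exI[of _ k]) auto
  qed
  then obtain k where "k \<notin> A" "\<And>m. m \<notin> A \<Longrightarrow> norm (coef S m x) \<le> norm (coef S k x)"
    by blast
  with A have "greedy_set S (Suc N) x (insert k A)"
    by (auto simp: greedy_set_def)
  then show ?case by blast
qed

text \<open>Each scalar splits into its norm and a unimodular factor; the norms are the decreasing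
  weights, and the partial sums are signed sums.\<close>

lemma combination_bound:
  assumes fin: "finite A"
    and sgn: "\<And>\<epsilon> B. B \<subseteq> A \<Longrightarrow> (\<forall>j\<in>B. norm (\<epsilon> j) = 1) \<Longrightarrow>
      norm (signed_sum S \<epsilon> B) \<le> (\<Sum>j<card B. r j)"
    and f: "bij_betw f {..<card A} A"
      "\<And>i j. i \<le> j \<Longrightarrow> j < card A \<Longrightarrow> norm (c (f j)) \<le> norm (c (f i))"
  shows "norm (\<Sum>n\<in>A. scl S (c n) (vec S n)) \<le> (\<Sum>j<card A. norm (c (f j)) * r j)"
proof -
  \<comment> \<open>The value 1 at vanishing scalars keeps all factors unimodular.\<close>
  define \<epsilon> where "\<epsilon> n = (if c n = 0 then 1 else c n / of_real (norm (c n)))" for n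
  have \<epsilon>: "norm (\<epsilon> n) = 1" "c n = of_real (norm (c n)) * \<epsilon> n" for n
    by (auto simp: \<epsilon>_def norm_divide)
  have inj: "inj_on f {..<card A}" and im: "f ` {..<card A} = A"
    using f(1) by (auto simp: bij_betw_def)
  have "(\<Sum>n\<in>A. scl S (c n) (vec S n)) = (\<Sum>j<card A. scl S (c (f j)) (vec S (f j)))"
    by (rule sum.reindex_bij_betw[OF f(1), symmetric])
  also have "\<dots> = (\<Sum>j<card A. norm (c (f j)) *\<^sub>R scl S (\<epsilon> (f j)) (vec S (f j)))"
    by (subst \<epsilon>(2)) (simp add: scale_real_mult)
  also have "norm \<dots> \<le> (\<Sum>j<card A. norm (c (f j)) * r j)"
  proof (rule norm_sum_decreasing_weights_le)
    fix n assume n: "n \<le> card A"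
    then have inj_n: "inj_on f {..<n}" and "f ` {..<n} \<subseteq> A"
      using inj im by (auto intro: inj_on_subset)
    then have "norm (signed_sum S \<epsilon> (f ` {..<n})) \<le> (\<Sum>j<card (f ` {..<n}). r j)"
      using \<epsilon>(1) by (intro sgn) auto
    then show "norm (\<Sum>j<n. scl S (\<epsilon> (f j)) (vec S (f j))) \<le> (\<Sum>j<n. r j)"
      by (simp add: signed_sum_def sum.reindex[OF inj_n] card_image[OF inj_n])
  qed (use f(2) in auto)
  finally show ?thesis .
qed

end

section \<open>Parameter bounds from two fundamental functions\<close>

text \<open>For the given system \<open>\<eta>\<close> is D and \<open>\<theta>\<close> is D*; for
  the dual system they trade places. The subspace \<open>Y\<close> is an ambient space on which the
  coefficient bound holds, so that all estimates can be made without looking inside a closed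
  span.\<close>

locale bounded_bsystem = biorthogonal_bsystem S
  for S :: "('k::real_or_complex, 'a::real_normed_vector) bsystem" +
  fixes Y :: "'a set" and \<eta> \<theta> :: "nat \<Rightarrow> real"
  assumes subspace_Y: "subspace Y" and spc_Y: "spc S \<subseteq> Y" and vec_Y: "vec S n \<in> Y"
    and fund: "fundamental \<eta>" "fundamental \<theta>"
    and sgn_le: "finite A \<Longrightarrow> (\<And>j. j \<in> A \<Longrightarrow> norm (\<epsilon> j) = 1) \<Longrightarrow>
      norm (signed_sum S \<epsilon> A) \<le> \<eta> (card A)"
    and coef_le: "finite A \<Longrightarrow> x \<in> Y \<Longrightarrow> (\<Sum>n\<in>A. norm (coef S n x)) \<le> \<theta> (card A) * norm x"
    and one_le: "1 \<le> \<eta> 1 * \<theta> 1"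
begin

lemma combination_in_Y: "(\<Sum>n\<in>A. scl S (c n) (vec S n)) \<in> Y"
  by (intro subspace_sum subspace_scale subspace_Y vec_Y)

lemma norm_proj_le:
  assumes "finite A" "card A \<le> N" "x \<in> Y"
  shows "norm (proj S A x) \<le> tsum \<theta> \<eta> N * norm x" "norm (proj S A x) \<le> tsum \<eta> \<theta> N * norm x"
proof -
  define M where "M = card A"
  obtain f where f: "bij_betw f {..<M} A"
    "\<And>i j. i \<le> j \<Longrightarrow> j < M \<Longrightarrow> norm (coef S (f j) x) \<le> norm (coef S (f i) x)"
    using ex_decreasing_enumeration[OF assms(1), of "\<lambda>n. norm (coef S n x)"] M_def by auto
  have inj: "inj_on f {..<n}" "f ` {..<n} \<subseteq> A" if "n \<le> M" for n
    using f(1) that by (auto simp: bij_betw_def intro: inj_on_subset)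
  have part: "(\<Sum>i<n. norm (coef S (f i) x)) \<le> \<theta> n * norm x" if "n \<le> M" for n
    using coef_le[of "f ` {..<n}" x] inj[OF that] assms(3)
    by (simp add: sum.reindex card_image)
  \<comment> \<open>The smallest of the first \<open>Suc j\<close> coefficients is at most their
    average.\<close>
  have coef: "norm (coef S (f j) x) \<le> \<theta> (Suc j) / real (Suc j) * norm x" if "j < M" for j
  proof -
    have "real (Suc j) * norm (coef S (f j) x) \<le> (\<Sum>i<Suc j. norm (coef S (f i) x))"
      using sum_bounded_below[of "{..<Suc j}" "norm (coef S (f j) x)" "\<lambda>i. norm (coef S (f i) x)"]
        f(2)[OF _ that] by auto
    also have "\<dots> \<le> \<theta> (Suc j) * norm x"
      using that by (intro part) auto
    finally show ?thesis by (simp add: field_simps)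
  qed
  have bound: "norm (proj S A x) \<le> (\<Sum>j<M. norm (coef S (f j) x) * r j)"
    if r: "\<And>n. \<eta> n \<le> (\<Sum>j<n. r j)" for r
    unfolding proj_def M_def
  proof (rule combination_bound)
    show "norm (signed_sum S \<epsilon> B) \<le> (\<Sum>j<card B. r j)"
      if "B \<subseteq> A" "\<forall>j\<in>B. norm (\<epsilon> j) = 1" for \<epsilon> B
      using sgn_le[of B \<epsilon>] r[of "card B"] that assms(1) finite_subset by fastforce
  qed (use f assms(1) M_def in auto)
  have "norm (proj S A x) \<le> (\<Sum>j<M. norm (coef S (f j) x) * (\<eta> (Suc j) - \<eta> j))"
    using fundamentalD(1)[OF fund(1)] by (intro bound) (simp add: sum_lessThan_telescope)
  also have "\<dots> \<le> (\<Sum>j<M. (\<theta> (Suc j) / real (Suc j) * norm x) * (\<eta> (Suc j) - \<eta> j))"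
    using fundamentalD(2)[OF fund(1)] coef by (intro sum_mono mult_right_mono) auto
  also have "\<dots> = tsum \<theta> \<eta> M * norm x"
    by (simp add: tsum_def sum_distrib_left mult_ac)
  also have "\<dots> \<le> tsum \<theta> \<eta> N * norm x"
    using assms(2) M_def by (intro mult_right_mono tsum_mono fund) auto
  finally show "norm (proj S A x) \<le> tsum \<theta> \<eta> N * norm x" .
  have "norm (proj S A x) \<le> (\<Sum>j<M. norm (coef S (f j) x) * (\<eta> (Suc j) / real (Suc j)))"
    by (intro bound fundamental_le_sum_ratios fund)
  \<comment> \<open>The roles are now reversed: the ratios of \<open>\<eta>\<close> are the
    decreasing weights and the coefficients are the summed vectors, here real numbers.\<close>
  also have "\<dots> = norm (\<Sum>j<M. (\<eta> (Suc j) / real (Suc j)) *\<^sub>R norm (coef S (f j) x))"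
    using fundamentalD(3)[OF fund(1)] by (simp add: mult.commute sum_nonneg)
  also have "\<dots> \<le> (\<Sum>j<M. \<eta> (Suc j) / real (Suc j) * ((\<theta> (Suc j) - \<theta> j) * norm x))"
  proof (rule norm_sum_decreasing_weights_le)
    show "norm (\<Sum>j<n. norm (coef S (f j) x)) \<le> (\<Sum>j<n. (\<theta> (Suc j) - \<theta> j) * norm x)"
      if "n \<le> M" for n
      using part[OF that] fundamentalD(1)[OF fund(2)]
      by (simp add: sum_nonneg sum_lessThan_telescope sum_distrib_right[symmetric])
  qed (use fundamentalD(3,4)[OF fund(1)] in \<open>auto simp del: of_nat_Suc\<close>)
  also have "\<dots> = tsum \<eta> \<theta> M * norm x"
    by (simp add: tsum_def sum_distrib_left mult_ac)
  also have "\<dots> \<le> tsum \<eta> \<theta> N * norm x"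
    using assms(2) M_def by (intro mult_right_mono tsum_mono fund) auto
  finally show "norm (proj S A x) \<le> tsum \<eta> \<theta> N * norm x" .
qed

text \<open>The real form of \<open>T_bar\<close>. It is symmetric in \<open>\<eta>\<close> and
  \<open>\<theta>\<close>, hence the same for a system and its dual.\<close>

definition tmin :: "nat \<Rightarrow> real"
  where "tmin N = min (tsum \<eta> \<theta> N) (tsum \<theta> \<eta> N)"

lemma norm_proj_le_tmin:
  "finite A \<Longrightarrow> card A \<le> N \<Longrightarrow> x \<in> Y \<Longrightarrow> norm (proj S A x) \<le> tmin N * norm x"
  using norm_proj_le[of A N x] by (auto simp: tmin_def min_def)

lemma product_ratio_le_tmin:
  "0 < k \<Longrightarrow> k \<le> N \<Longrightarrow> \<eta> k * \<theta> k / real k \<le> tmin N"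
  using product_ratio_le_tsum[of \<eta> \<theta> k N] product_ratio_le_tsum[of \<theta> \<eta> k N] fund
  by (simp add: tmin_def mult.commute)

lemma one_le_tmin: "1 \<le> N \<Longrightarrow> 1 \<le> tmin N"
  using product_ratio_le_tmin[of 1 N] one_le by simp

text \<open>With the increments of \<open>\<eta>\<close> as dominating sequence, each weight can be
  raised to \<alpha> and the sum telescopes.\<close>

lemma combination_le_max_coef:
  assumes fin: "finite A" and le: "\<And>n. n \<in> A \<Longrightarrow> norm (c n) \<le> \<alpha>" and "0 \<le> \<alpha>"
  shows "norm (\<Sum>n\<in>A. scl S (c n) (vec S n)) \<le> \<alpha> * \<eta> (card A)"
proof -
  obtain f where f: "bij_betw f {..<card A} A"
    "\<And>i j. i \<le> j \<Longrightarrow> j < card A \<Longrightarrow> norm (c (f j)) \<le> norm (c (f i))"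
    using ex_decreasing_enumeration[OF fin, of "\<lambda>n. norm (c n)"] by auto
  have tele: "(\<Sum>j<n. \<eta> (Suc j) - \<eta> j) = \<eta> n" for n
    using fundamentalD(1)[OF fund(1)] by (simp add: sum_lessThan_telescope)
  have "norm (\<Sum>n\<in>A. scl S (c n) (vec S n)) \<le> (\<Sum>j<card A. norm (c (f j)) * (\<eta> (Suc j) - \<eta> j))"
  proof (rule combination_bound)
    show "norm (signed_sum S \<epsilon> B) \<le> (\<Sum>j<card B. \<eta> (Suc j) - \<eta> j)"
      if "B \<subseteq> A" "\<forall>j\<in>B. norm (\<epsilon> j) = 1" for \<epsilon> B
      unfolding tele using that fin finite_subset by (intro sgn_le) auto
  qed (use f fin in auto)
  also have "\<dots> \<le> (\<Sum>j<card A. \<alpha> * (\<eta> (Suc j) - \<eta> j))"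
    using bij_betwE[OF f(1)] le fundamentalD(2)[OF fund(1)]
    by (intro sum_mono mult_right_mono) auto
  finally show ?thesis by (simp add: sum_distrib_left[symmetric] tele)
qed

text \<open>With \<open>z\<close> the error of the competitor, \<open>x - proj S A x\<close> is
  \<open>z\<close> minus its projections to \<open>A\<close> and \<open>B - A\<close>, plus the
  projection of \<open>x\<close> to \<open>B - A\<close>. The last term is controlled by greediness:
  the coefficients of \<open>x\<close> on \<open>B - A\<close> do not exceed those on
  \<open>A - B\<close>, where \<open>x\<close> and \<open>z\<close> have the same coefficients. Each
  of the four terms is at most \<open>tmin N * norm z\<close>.\<close>

lemma greedy_error_le:
  assumes x: "x \<in> Y" and N: "1 \<le> N" and A: "greedy_set S N x A"
    and B: "finite B" "card B \<le> N"
  shows "norm (x - proj S A x) \<le> 4 * tmin N * norm (x - (\<Sum>n\<in>B. scl S (c n) (vec S n)))"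
proof -
  define y where "y = (\<Sum>n\<in>B. scl S (c n) (vec S n))"
  define z where "z = x - y"
  have finA: "finite A" and cardA: "card A = N"
    and gr: "\<And>n m. n \<in> A \<Longrightarrow> m \<notin> A \<Longrightarrow> norm (coef S m x) \<le> norm (coef S n x)"
    using A by (auto simp: greedy_set_def)
  have zY: "z \<in> Y"
    unfolding z_def y_def by (intro subspace_diff subspace_Y x combination_in_Y)
  have cardBA: "card (B - A) \<le> N"
    using card_mono[OF B(1), of "B - A"] B by auto
  have "proj S (A \<union> (B - A)) y = y"
    unfolding y_def using finA B by (intro proj_combination) auto
  moreover have "proj S (A \<union> (B - A)) v = proj S A v + proj S (B - A) v" for v
    using finA B by (intro proj_union_disjoint) auto
  ultimately have "y = proj S A x + proj S (B - A) x - proj S A z - proj S (B - A) z"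
    by (simp add: z_def proj_diff algebra_simps)
  then have decomp: "x - proj S A x = z - proj S A z - proj S (B - A) z + proj S (B - A) x"
    by (simp add: z_def algebra_simps)
  have "norm (proj S (B - A) x) \<le> tmin N * norm z"
  proof (cases "B - A = {}")
    case True
    then show ?thesis
      unfolding True using one_le_tmin[OF N] by (simp add: proj_def)
  next
    case False
    define k where "k = card (B - A)"
    have k: "0 < k" "k \<le> N"
      using False B cardBA by (auto simp: k_def card_gt_0_iff)
    \<comment> \<open>As \<open>card B \<le> card A\<close>, the set \<open>A - B\<close> has room
      for as many indices as \<open>B - A\<close>.\<close>
    have "k + card (A \<inter> B) \<le> card (A - B) + card (A \<inter> B)"
      using B cardA finA card_Diff_subset_Int[of B A] card_Diff_subset_Int[of A B]
        card_mono[OF B(1), of "A \<inter> B"] card_mono[OF finA, of "A \<inter> B"]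
      by (simp add: k_def Int_commute)
    then obtain A' where A': "A' \<subseteq> A - B" "card A' = k" "finite A'"
      using obtain_subset_with_card_n[of k "A - B"] by auto
    define \<alpha> where "\<alpha> = Min ((\<lambda>n. norm (coef S n x)) ` A')"
    have ne: "A' \<noteq> {}"
      using A'(2) k by auto
    have "\<alpha> \<in> (\<lambda>n. norm (coef S n x)) ` A'"
      unfolding \<alpha>_def using ne A' by (intro Min_in) auto
    then obtain a where a: "a \<in> A'" "\<alpha> = norm (coef S a x)"
      by auto
    have "real k * \<alpha> \<le> (\<Sum>n\<in>A'. norm (coef S n x))"
      using sum_bounded_below[of A' \<alpha> "\<lambda>n. norm (coef S n x)"] A' by (auto simp: \<alpha>_def)
    \<comment> \<open>The competitor is supported in \<open>B\<close>, which \<open>A'\<close>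
      avoids.\<close>
    also have "\<dots> = (\<Sum>n\<in>A'. norm (coef S n z))"
      using A' B by (intro sum.cong) (auto simp: z_def y_def coef_diff coef_combination)
    also have "\<dots> \<le> \<theta> k * norm z"
      using coef_le[OF A'(3) zY] A' by simp
    finally have \<alpha>_le: "\<alpha> \<le> \<theta> k * norm z / real k"
      using k by (simp add: field_simps)
    have "norm (proj S (B - A) x) \<le> \<alpha> * \<eta> k"
      unfolding proj_def k_def using B a A' gr by (intro combination_le_max_coef) auto
    also have "\<dots> \<le> \<theta> k * norm z / real k * \<eta> k"
      using \<alpha>_le fundamentalD(3)[OF fund(1)] by (rule mult_right_mono)
    also have "\<dots> = \<eta> k * \<theta> k / real k * norm z"
      by simp
    also have "\<dots> \<le> tmin N * norm z"
      using k by (intro mult_right_mono product_ratio_le_tmin) auto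
    finally show ?thesis .
  qed
  moreover have "norm (proj S A z) \<le> tmin N * norm z" "norm (proj S (B - A) z) \<le> tmin N * norm z"
    using finA cardA B cardBA zY by (auto intro!: norm_proj_le_tmin)
  moreover have "norm z \<le> tmin N * norm z"
    using mult_right_mono[OF one_le_tmin[OF N], of "norm z"] by simp
  moreover have "norm (x - proj S A x) \<le>
      norm z + norm (proj S A z) + norm (proj S (B - A) z) + norm (proj S (B - A) x)"
    unfolding decomp by (intro norm_triangle_le norm_triangle_le_diff add_right_mono) auto
  ultimately show ?thesis
    by (simp add: z_def y_def)
qed

lemma Leb_le: "1 \<le> N \<Longrightarrow> Leb S N \<le> ereal (4 * tmin N)"
proof -
  assume N: "1 \<le> N"
  have "norm (x - G x) \<le> 4 * tmin N * sigma S N x"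
    if x: "x \<in> spc S" and G: "G \<in> greedy_ops S N" for x G
  proof -
    obtain A where A: "greedy_set S N x A" "G x = proj S A x"
      using x G by (auto simp: greedy_ops_def)
    have pos: "0 < 4 * tmin N"
      using one_le_tmin[OF N] by simp
    \<comment> \<open>Division by the positive constant turns the claim into a lower bound for every
      member of the set defining the infimum; that set is nonempty because of the empty index
      set.\<close>
    have "norm (x - G x) / (4 * tmin N) \<le> sigma S N x"
      unfolding sigma_def
    proof (rule cInf_greatest)
      fix w assume "w \<in> {norm (x - (\<Sum>n\<in>B. scl S (c n) (vec S n))) |B c. finite B \<and> card B \<le> N}"
      then show "norm (x - G x) / (4 * tmin N) \<le> w"
        using greedy_error_le[OF _ N A(1)] x spc_Y pos A(2)
        by (auto simp: pos_divide_le_eq mult_ac)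
    qed (auto intro!: exI[of _ "{}"])
    then show ?thesis
      using pos by (simp add: pos_divide_le_eq mult_ac)
  qed
  then show ?thesis
    unfolding Leb_def by (intro Inf_lower) blast
qed

lemma Leb_tilde_le: "1 \<le> N \<Longrightarrow> Leb_tilde S N \<le> ereal (4 * tmin N)"
proof -
  assume N: "1 \<le> N"
  have "norm (x - G x) \<le> 4 * tmin N * sigma_tilde S N x"
    if x: "x \<in> spc S" and G: "G \<in> greedy_ops S N" for x G
  proof -
    obtain A where A: "greedy_set S N x A" "G x = proj S A x"
      using x G by (auto simp: greedy_ops_def)
    have pos: "0 < 4 * tmin N"
      using one_le_tmin[OF N] by simp
    have "norm (x - G x) / (4 * tmin N) \<le> sigma_tilde S N x"
      unfolding sigma_tilde_def
    proof (rule cInf_greatest)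
      fix w assume "w \<in> {norm (x - proj S B x) |B. finite B \<and> card B \<le> N}"
      then show "norm (x - G x) / (4 * tmin N) \<le> w"
        \<comment> \<open>Choosing the coefficients of \<open>x\<close> as scalars turns the
          competitor into a projection.\<close>
        using greedy_error_le[OF _ N A(1), of _ "\<lambda>n. coef S n x"] x spc_Y pos A(2)
        by (auto simp: pos_divide_le_eq mult_ac proj_def)
    qed (auto intro!: exI[of _ "{}"])
    then show ?thesis
      using pos by (simp add: pos_divide_le_eq mult_ac)
  qed
  then show ?thesis
    unfolding Leb_tilde_def by (intro Inf_lower) blast
qed

text \<open>The index set may vary with \<open>x\<close>, so that fixed projections and nonlinear
  greedy operators are covered at once.\<close>

lemma op_norm_proj_le:
  assumes "\<And>x. x \<in> spc S \<Longrightarrow> \<exists>A. finite A \<and> card A \<le> N \<and> G x = proj S A x"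
  shows "op_norm S G \<le> ereal (tmin N)"
  unfolding op_norm_def
proof (rule SUP_least)
  fix x assume x: "x \<in> {x \<in> spc S. x \<noteq> 0}"
  then obtain A where "finite A" "card A \<le> N" "G x = proj S A x"
    using assms by blast
  then show "ereal (norm (G x) / norm x) \<le> ereal (tmin N)"
    using norm_proj_le_tmin[of A N x] x spc_Y by (auto simp: pos_divide_le_eq)
qed

lemma K_par_le: "K_par S N \<le> ereal (tmin N)"
  unfolding K_par_def by (intro SUP_least op_norm_proj_le) auto

lemma g_par_le: "g_par S N \<le> ereal (tmin N)"
  unfolding g_par_def
  by (intro SUP_least op_norm_proj_le) (fastforce simp: greedy_ops_def greedy_set_def)

end

section \<open>Quasi-greedy and democratic systems\<close>

text \<open>In the complex case \<open>z\<close> is multiplied by its conjugate: with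
  \<open>m\<close> the larger of the absolute values of the two parts, \<open>m * m\<close> is at
  most \<open>norm z * (2 * m)\<close>. In the real case \<open>i\<close> is 1 and the second part
  is 0.\<close>

lemma real_or_complex_parts:
  obtains i :: "'k::real_or_complex" where "norm i = 1"
    and "\<And>z. \<exists>a b. z = of_real a + i * of_real b \<and> \<bar>a\<bar> \<le> 2 * norm z \<and> \<bar>b\<bar> \<le> 2 * norm z"
proof (cases "\<forall>z::'k. \<exists>a. z = a *\<^sub>R 1")
  case True
  have "\<exists>a b. z = of_real a + 1 * of_real b \<and> \<bar>a\<bar> \<le> 2 * norm z \<and> \<bar>b\<bar> \<le> 2 * norm z" for z :: 'k
  proof -
    obtain a where "z = a *\<^sub>R 1" using True by blast
    then show ?thesis
      by (intro exI[of _ a] exI[of _ 0]) (simp add: of_real_def)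
  qed
  then show thesis using that[of 1] by simp
next
  case False
  then obtain i :: 'k where i: "i * i = - 1" "\<And>z. \<exists>a b. z = a *\<^sub>R 1 + b *\<^sub>R i"
    using real_or_complex by blast
  have "norm i * norm i = 1"
    by (metis i(1) norm_minus_cancel norm_mult norm_one)
  then have norm_i: "norm i = 1"
    by (metis abs_norm_cancel abs_of_nonneg norm_ge_zero real_sqrt_abs2 real_sqrt_one)
  show thesis
  proof (rule that[OF norm_i])
    fix z :: 'k
    obtain a b where z: "z = of_real a + i * of_real b"
      using i(2)[of z] by (auto simp: of_real_def)
    define m where "m = max \<bar>a\<bar> \<bar>b\<bar>"
    have "m ^ 2 \<le> a ^ 2 + b ^ 2"
      by (auto simp: m_def max_def)
    also have "\<dots> = norm (of_real (a ^ 2 + b ^ 2) :: 'k)"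
      unfolding norm_of_real by simp
    also have "(of_real (a ^ 2 + b ^ 2) :: 'k) = z * (of_real a - i * of_real b)"
    proof -
      have "z * (of_real a - i * of_real b) =
          of_real a * of_real a - (i * i) * (of_real b * of_real b)"
        unfolding z by (simp add: algebra_simps)
      then show ?thesis
        unfolding i(1) by (simp add: power2_eq_square)
    qed
    also have "norm \<dots> = norm z * norm (of_real a - i * of_real b :: 'k)"
      by (rule norm_mult)
    also have "\<dots> \<le> norm z * (\<bar>a\<bar> + \<bar>b\<bar>)"
      using norm_triangle_ineq4[of "of_real a :: 'k" "i * of_real b"] norm_i
      by (intro mult_left_mono) (simp_all add: norm_mult)
    also have "\<dots> \<le> norm z * (2 * m)"
      by (intro mult_left_mono) (simp_all add: m_def max_def)
    finally have "m * m \<le> (2 * norm z) * m"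
      by (simp add: power2_eq_square mult_ac)
    moreover have "0 \<le> m"
      by (simp add: m_def)
    ultimately have "m \<le> 2 * norm z"
      by (cases "m = 0") (auto simp: mult_le_cancel_right)
    then have "\<bar>a\<bar> \<le> 2 * norm z \<and> \<bar>b\<bar> \<le> 2 * norm z"
      by (simp add: m_def)
    with z show "\<exists>a b. z = of_real a + i * of_real b \<and> \<bar>a\<bar> \<le> 2 * norm z \<and> \<bar>b\<bar> \<le> 2 * norm z"
      by blast
  qed
qed

context biorthogonal_bsystem
begin

text \<open>
  The existence of greedy sets for all vectors is essential: otherwise there are no greedy
  operators and \<open>quasi_greedy\<close> holds vacuously.
\<close>
lemma greedy_projections_bounded:
  assumes qg: "quasi_greedy S"
    and ex: "\<And>x N. x \<in> spc S \<Longrightarrow> \<exists>A. greedy_set S N x A"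
  obtains C where "0 \<le> C"
    and "\<And>x A N. x \<in> spc S \<Longrightarrow> greedy_set S N x A \<Longrightarrow> norm (proj S A x) \<le> C * norm x"
proof -
  define s where "s = (SUP N\<in>{1..}. g_par S N)"
  define C where "C = max 0 (real_of_ereal s)"
  have "s < \<infinity>"
    using qg by (simp add: quasi_greedy_def s_def)
  then have sC: "s \<le> ereal C"
    by (cases s) (auto simp: C_def)
  have "norm (proj S A x) \<le> C * norm x" if x: "x \<in> spc S" and A: "greedy_set S N x A" for x A N
  \<comment> \<open>\<open>g_par\<close> starts at order 1 and \<open>op_norm\<close> leaves out the
    zero vector, so these cases are treated separately.\<close>
  proof (cases "x = 0 \<or> N = 0")
    case True
    then have "proj S A x = 0"
      using A by (auto simp: greedy_set_def proj_def)
    then show ?thesis by (simp add: C_def)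
  next
    case False
    \<comment> \<open>The single choice of \<open>A\<close> at \<open>x\<close> is extended to a
      full greedy operator by arbitrary greedy sets elsewhere.\<close>
    define A' where "A' y = (if y = x then A else SOME B. greedy_set S N y B)" for y
    define G where "G y = proj S (A' y) y" for y
    have "greedy_set S N y (A' y)" if "y \<in> spc S" for y
      using someI_ex[OF ex[OF that]] A by (simp add: A'_def)
    then have G: "G \<in> greedy_ops S N"
      by (auto simp: greedy_ops_def G_def)
    have "ereal (norm (G x) / norm x) \<le> op_norm S G"
      unfolding op_norm_def using x False by (intro SUP_upper) auto
    also have "\<dots> \<le> g_par S N"
      unfolding g_par_def using False G
      by (intro SUP_upper2[of N] SUP_upper2[of G]) auto
    also have "\<dots> \<le> s"
      unfolding s_def using False by (intro SUP_upper) auto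
    also note sC
    finally show ?thesis
      using False by (simp add: pos_divide_le_eq G_def A'_def)
  qed
  then show thesis using that[of C] by (simp add: C_def)
qed

context
  fixes C :: real
  assumes greedy_bound: "\<And>x A N. greedy_set S N x A \<Longrightarrow> norm (proj S A x) \<le> C * norm x"
    and C_nonneg: "0 \<le> C"
begin

text \<open>The coefficients of a signed sum have norm 1 on \<open>A\<close> and vanish elsewhere,
  so every subset of \<open>A\<close> is a greedy set for it.\<close>

lemma signed_subsum_le:
  assumes A: "finite A" "\<And>n. n \<in> A \<Longrightarrow> norm (\<epsilon> n) = 1" and B: "B \<subseteq> A"
  shows "norm (signed_sum S \<epsilon> B) \<le> C * norm (signed_sum S \<epsilon> A)"
proof -
  have coef: "coef S n (signed_sum S \<epsilon> A) = (if n \<in> A then \<epsilon> n else 0)" for n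
    unfolding signed_sum_def by (rule coef_combination[OF A(1)])
  have "greedy_set S (card B) (signed_sum S \<epsilon> A) B"
    using A B by (auto simp: greedy_set_def coef finite_subset)
  moreover have "proj S B (signed_sum S \<epsilon> A) = signed_sum S \<epsilon> B"
    using B by (auto simp: coef proj_def signed_sum_def[of S \<epsilon> B] intro!: sum.cong)
  ultimately show ?thesis
    using greedy_bound by metis
qed

text \<open>Positive and negative parts of the multiplier are handled separately, whence the factor
  2. After sorting, the partial sums are subsums of the signed sum.\<close>

lemma real_multiplier_le:
  assumes A: "finite A" "\<And>n. n \<in> A \<Longrightarrow> norm (\<epsilon> n) = 1"
    and c: "\<And>n. n \<in> A \<Longrightarrow> \<bar>c n\<bar> \<le> M" and "0 \<le> M"
  shows "norm (\<Sum>n\<in>A. c n *\<^sub>R scl S (\<epsilon> n) (vec S n)) \<le> 2 * M * (C * norm (signed_sum S \<epsilon> A))"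
proof -
  define K where "K = C * norm (signed_sum S \<epsilon> A)"
  have K: "0 \<le> K"
    using C_nonneg by (simp add: K_def)
  have nonneg_case: "norm (\<Sum>n\<in>A. d n *\<^sub>R scl S (\<epsilon> n) (vec S n)) \<le> M * K"
    if d: "\<And>n. n \<in> A \<Longrightarrow> 0 \<le> d n \<and> d n \<le> M" for d
  proof -
    obtain f where f: "bij_betw f {..<card A} A"
      "\<And>i j. i \<le> j \<Longrightarrow> j < card A \<Longrightarrow> d (f j) \<le> d (f i)"
      using ex_decreasing_enumeration[OF A(1), of d] by auto
    have "(\<Sum>n\<in>A. d n *\<^sub>R scl S (\<epsilon> n) (vec S n)) =
        (\<Sum>j<card A. d (f j) *\<^sub>R scl S (\<epsilon> (f j)) (vec S (f j)))"
      by (rule sum.reindex_bij_betw[OF f(1), symmetric])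
    also have "norm \<dots> \<le> M * K"
    proof (rule norm_sum_decreasing_weights_le_const)
      fix n assume n: "n \<le> card A"
      then have inj: "inj_on f {..<n}" and sub: "f ` {..<n} \<subseteq> A"
        using f(1) by (auto simp: bij_betw_def intro: inj_on_subset)
      have "norm (signed_sum S \<epsilon> (f ` {..<n})) \<le> K"
        unfolding K_def using A sub by (intro signed_subsum_le)
      then show "norm (\<Sum>j<n. scl S (\<epsilon> (f j)) (vec S (f j))) \<le> K"
        by (simp add: signed_sum_def sum.reindex[OF inj])
    qed (use f(2) d bij_betwE[OF f(1)] \<open>0 \<le> M\<close> in auto)
    finally show ?thesis .
  qed
  have "(\<Sum>n\<in>A. c n *\<^sub>R scl S (\<epsilon> n) (vec S n)) =
      (\<Sum>n\<in>A. (max (c n) 0) *\<^sub>R scl S (\<epsilon> n) (vec S n)) -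
      (\<Sum>n\<in>A. (max (- c n) 0) *\<^sub>R scl S (\<epsilon> n) (vec S n))"
    unfolding sum_subtractf[symmetric] scaleR_left_diff_distrib[symmetric]
    by (intro sum.cong) (auto simp: max_def)
  also have "norm \<dots> \<le> M * K + M * K"
    using c \<open>0 \<le> M\<close> by (intro norm_triangle_le_diff add_mono nonneg_case) (force simp: abs_le_iff)+
  finally show ?thesis by (simp add: K_def mult_ac)
qed

text \<open>
  A unimodular scalar is split into a real and an imaginary part.  The norm of the field is not
  identified with the modulus, so these parts are only known to be at most 2, whence the constant.
\<close>
lemma multiplier_le:
  assumes A: "finite A" "\<And>n. n \<in> A \<Longrightarrow> norm (\<epsilon> n) = 1"
    and c: "\<And>n. n \<in> A \<Longrightarrow> norm (c n) = 1"
  shows "norm (\<Sum>n\<in>A. scl S (c n * \<epsilon> n) (vec S n)) \<le> 8 * C * norm (signed_sum S \<epsilon> A)"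
proof -
  obtain i :: 'k where i: "norm i = 1"
    "\<And>z. \<exists>a b. z = of_real a + i * of_real b \<and> \<bar>a\<bar> \<le> 2 * norm z \<and> \<bar>b\<bar> \<le> 2 * norm z"
    using real_or_complex_parts by blast
  from i(2) obtain a b where ab: "\<And>z. z = of_real (a z) + i * of_real (b z)"
    "\<And>z. \<bar>a z\<bar> \<le> 2 * norm z" "\<And>z. \<bar>b z\<bar> \<le> 2 * norm z"
    by metis
  let ?u = "\<lambda>n. scl S (\<epsilon> n) (vec S n)"
  \<comment> \<open>One factor 2 comes from \<open>real_multiplier_le\<close>, the other bounds the
    parts of a unimodular scalar.\<close>
  have bound: "norm (\<Sum>n\<in>A. g (c n) *\<^sub>R ?u n) \<le> 2 * 2 * (C * norm (signed_sum S \<epsilon> A))"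
    if "\<And>z. \<bar>g z\<bar> \<le> 2 * norm z" for g
    using A c that by (intro real_multiplier_le) (auto, metis mult.right_neutral)
  have "scl S (c n * \<epsilon> n) (vec S n) = a (c n) *\<^sub>R ?u n + scl S i (b (c n) *\<^sub>R ?u n)" for n
    by (subst ab(1)[of "c n"]) (simp add: scale_left_distrib distrib_right mult.assoc
        scale_real_mult scal_of_real scale_scale[symmetric] del: scale_scale)
  then have "(\<Sum>n\<in>A. scl S (c n * \<epsilon> n) (vec S n)) =
      (\<Sum>n\<in>A. a (c n) *\<^sub>R ?u n) + scl S i (\<Sum>n\<in>A. b (c n) *\<^sub>R ?u n)"
    by (simp add: sum.distrib scale_sum_right)
  also have "norm \<dots> \<le> 2 * 2 * (C * norm (signed_sum S \<epsilon> A)) + 2 * 2 * (C * norm (signed_sum S \<epsilon> A))"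
    using bound[of a] bound[of b] ab(2,3)
    by (intro norm_triangle_le add_mono) (simp_all add: norm_scal i(1))
  finally show ?thesis by simp
qed

text \<open>
  The signed sum is recovered from the greedy sums of \<open>x\<close> by weights \<open>1 / \<bar>e\<^sub>n*(x)\<bar>\<close>, which increase
  along the greedy ordering; subtracting them from \<open>1 / \<alpha>\<close> makes them decrease.
\<close>
lemma min_coef_signed_sum_le:
  assumes A: "greedy_set S N x A" and \<alpha>: "0 < \<alpha>" "\<And>n. n \<in> A \<Longrightarrow> \<alpha> \<le> norm (coef S n x)"
    and \<epsilon>: "\<And>n. n \<in> A \<Longrightarrow> coef S n x = of_real (norm (coef S n x)) * \<epsilon> n"
  shows "\<alpha> * norm (signed_sum S \<epsilon> A) \<le> 2 * C * norm x"
proof -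
  have fin: "finite A"
    using A by (simp add: greedy_set_def)
  define K where "K = C * norm x"
  have K: "0 \<le> K"
    using C_nonneg by (simp add: K_def)
  obtain f where f: "bij_betw f {..<card A} A"
    "\<And>i j. i \<le> j \<Longrightarrow> j < card A \<Longrightarrow> norm (coef S (f j) x) \<le> norm (coef S (f i) x)"
    using ex_decreasing_enumeration[OF fin, of "\<lambda>n. norm (coef S n x)"] by auto
  have fA: "f j \<in> A" if "j < card A" for j
    using bij_betwE[OF f(1)] that by auto
  let ?v = "\<lambda>j. scl S (coef S (f j) x) (vec S (f j))"
  let ?b = "\<lambda>j. 1 / norm (coef S (f j) x)"
  have part: "norm (\<Sum>j<n. ?v j) \<le> K" if n: "n \<le> card A" for n
  proof -
    have inj: "inj_on f {..<n}" and sub: "f ` {..<n} \<subseteq> A"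
      using f(1) n by (auto simp: bij_betw_def intro: inj_on_subset)
    \<comment> \<open>Initial segments of a greedy set in decreasing order are again greedy
      sets.\<close>
    have "greedy_set S n x (f ` {..<n})"
      unfolding greedy_set_def
    proof (intro conjI ballI allI impI)
      fix p m assume p: "p \<in> f ` {..<n}" and m: "m \<notin> f ` {..<n}"
      then obtain i where i: "i < n" "p = f i" by auto
      show "norm (coef S m x) \<le> norm (coef S p x)"
      proof (cases "m \<in> A")
        case True
        then obtain j where j: "j < card A" "m = f j"
          using f(1) by (auto simp: bij_betw_def)
        with m have "n \<le> j" by (meson image_eqI lessThan_iff not_le)
        then show ?thesis using f(2)[of i j] i j by simp
      next
        case False
        then show ?thesis
          using A sub p by (auto simp: greedy_set_def)
      qed
    qed (auto simp: card_image[OF inj])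
    from greedy_bound[OF this] have "norm (proj S (f ` {..<n}) x) \<le> K"
      by (simp add: K_def)
    then show ?thesis
      by (simp add: proj_def sum.reindex[OF inj])
  qed
  have b_le: "?b j \<le> 1 / \<alpha>" if "j < card A" for j
    using \<alpha> fA[OF that] by (intro divide_left_mono) (auto intro!: mult_pos_pos intro: less_le_trans)
  have "signed_sum S \<epsilon> A = (\<Sum>j<card A. scl S (\<epsilon> (f j)) (vec S (f j)))"
    unfolding signed_sum_def by (rule sum.reindex_bij_betw[OF f(1), symmetric])
  also have "\<dots> = (\<Sum>j<card A. ?b j *\<^sub>R ?v j)"
  proof (intro sum.cong refl)
    fix j assume "j \<in> {..<card A}"
    then have fj: "f j \<in> A" by (auto intro: fA)
    then have "0 < norm (coef S (f j) x)"
      using \<alpha>(1) \<alpha>(2)[OF fj] by linarith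
    moreover have "?v j = norm (coef S (f j) x) *\<^sub>R scl S (\<epsilon> (f j)) (vec S (f j))"
      by (metis scale_real_mult \<epsilon>[OF fj])
    ultimately show "scl S (\<epsilon> (f j)) (vec S (f j)) = ?b j *\<^sub>R ?v j"
      by simp
  qed
  also have "\<dots> = (1 / \<alpha>) *\<^sub>R (\<Sum>j<card A. ?v j) - (\<Sum>j<card A. (1 / \<alpha> - ?b j) *\<^sub>R ?v j)"
    by (simp add: scaleR_sum_right sum_subtractf[symmetric] scaleR_left_diff_distrib)
  also have "norm \<dots> \<le> 1 / \<alpha> * K + 1 / \<alpha> * K"
  proof (intro norm_triangle_le_diff add_mono)
    have "norm (\<Sum>j<card A. ?v j) \<le> K"
      by (intro part) simp
    then show "norm ((1 / \<alpha>) *\<^sub>R (\<Sum>j<card A. ?v j)) \<le> 1 / \<alpha> * K"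
      using \<alpha>(1) by (simp add: divide_right_mono)
    show "norm (\<Sum>j<card A. (1 / \<alpha> - ?b j) *\<^sub>R ?v j) \<le> 1 / \<alpha> * K"
    proof (rule norm_sum_decreasing_weights_le_const)
      fix i j assume ij: "i \<le> j" "j < card A"
      have "0 < norm (coef S (f j) x)"
        using \<alpha>(1) \<alpha>(2)[OF fA[OF ij(2)]] by linarith
      then show "1 / \<alpha> - ?b j \<le> 1 / \<alpha> - ?b i"
        using f(2)[OF ij] by (intro diff_left_mono divide_left_mono) (auto intro!: mult_pos_pos)
    qed (use part b_le \<alpha>(1) in auto)
  qed
  finally have "norm (signed_sum S \<epsilon> A) \<le> 2 * K / \<alpha>"
    by simp
  then show ?thesis
    using \<alpha>(1) by (simp add: K_def field_simps)
qed

text \<open>The signs on \<open>B\<close> are removed at cost \<open>8 * C\<close>, democracy moves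
  the sum from \<open>B\<close> to \<open>A\<close>, the signs of the coefficients of
  \<open>x\<close> are inserted at cost \<open>8 * C\<close> again, and the resulting signed sum is
  compared with \<open>x\<close> at cost \<open>2 * C\<close>.\<close>

lemma min_coef_times_signed_sum_le:
  assumes dem: "democratic S"
  obtains M where "0 \<le> M"
    and "\<And>x A N \<alpha> B \<delta>. greedy_set S N x A \<Longrightarrow> 0 < \<alpha> \<Longrightarrow> (\<And>n. n \<in> A \<Longrightarrow> \<alpha> \<le> norm (coef S n x)) \<Longrightarrow>
      finite B \<Longrightarrow> card B = N \<Longrightarrow> (\<And>n. n \<in> B \<Longrightarrow> norm (\<delta> n) = 1) \<Longrightarrow>
      \<alpha> * norm (signed_sum S \<delta> B) \<le> M * norm x"
proof -
  obtain \<Delta>' where \<Delta>': "\<And>A B. finite A \<Longrightarrow> finite B \<Longrightarrow> card A = card B \<Longrightarrow>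
      norm (signed_sum S (\<lambda>_. 1) A) \<le> \<Delta>' * norm (signed_sum S (\<lambda>_. 1) B)"
    using dem unfolding democratic_def by metis
  \<comment> \<open>The constant in \<open>democratic\<close> carries no sign, so it is replaced by
    a nonnegative one.\<close>
  define \<Delta> where "\<Delta> = max 0 \<Delta>'"
  have \<Delta>: "norm (signed_sum S (\<lambda>_. 1) A) \<le> \<Delta> * norm (signed_sum S (\<lambda>_. 1) B)"
    if "finite A" "finite B" "card A = card B" for A B
    using \<Delta>'[OF that] by (rule order_trans) (simp add: \<Delta>_def mult_right_mono)
  have \<Delta>0: "0 \<le> \<Delta>" by (simp add: \<Delta>_def)
  show thesis
  proof (rule that[of "8 * C * \<Delta> * (8 * C) * (2 * C)"])
    show "0 \<le> 8 * C * \<Delta> * (8 * C) * (2 * C)"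
      using C_nonneg \<Delta>0 by simp
  next
    fix x A N \<alpha> B and \<delta> :: "nat \<Rightarrow> 'k"
    assume A: "greedy_set S N x A" and \<alpha>: "0 < \<alpha>" "\<And>n. n \<in> A \<Longrightarrow> \<alpha> \<le> norm (coef S n x)"
      and B: "finite B" "card B = N" "\<And>n. n \<in> B \<Longrightarrow> norm (\<delta> n) = 1"
    have finA: "finite A" "card A = N"
      using A by (auto simp: greedy_set_def)
    define \<epsilon> where "\<epsilon> n = coef S n x / of_real (norm (coef S n x))" for n
    have ne: "coef S n x \<noteq> 0" if "n \<in> A" for n
      using \<alpha>(1) \<alpha>(2)[OF that] by auto
    have \<epsilon>1: "norm (\<epsilon> n) = 1" if "n \<in> A" for n
      using ne[OF that] by (simp add: \<epsilon>_def norm_divide)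
    have inv: "inverse (\<epsilon> n) * \<epsilon> n = 1" if "n \<in> A" for n
      using \<epsilon>1[OF that] by (intro left_inverse) auto
    have "norm (signed_sum S \<delta> B) \<le> 8 * C * norm (signed_sum S (\<lambda>_. 1) B)"
      using multiplier_le[of B "\<lambda>_. 1" \<delta>] B by (simp add: signed_sum_def)
    also have "\<dots> \<le> 8 * C * (\<Delta> * norm (signed_sum S (\<lambda>_. 1) A))"
      using C_nonneg B finA by (intro mult_left_mono \<Delta>) auto
    also have "norm (signed_sum S (\<lambda>_. 1) A) = norm (\<Sum>n\<in>A. scl S (inverse (\<epsilon> n) * \<epsilon> n) (vec S n))"
      by (auto simp: signed_sum_def inv intro!: arg_cong[where f=norm] sum.cong)
    also have "\<dots> \<le> 8 * C * norm (signed_sum S \<epsilon> A)"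
      using finA \<epsilon>1 by (intro multiplier_le) (auto simp: norm_inverse)
    finally have "norm (signed_sum S \<delta> B) \<le> 8 * C * (\<Delta> * (8 * C * norm (signed_sum S \<epsilon> A)))"
      using C_nonneg \<Delta>0 by (simp add: mult_left_mono)
    then have "\<alpha> * norm (signed_sum S \<delta> B) \<le> 8 * C * \<Delta> * (8 * C) * (\<alpha> * norm (signed_sum S \<epsilon> A))"
      using \<alpha>(1) by (simp add: mult_left_mono mult_ac)
    also have "\<dots> \<le> 8 * C * \<Delta> * (8 * C) * (2 * C * norm x)"
      using C_nonneg \<Delta>0 ne
      by (intro mult_left_mono min_coef_signed_sum_le[OF A \<alpha>]) (auto simp: \<epsilon>_def)
    finally show "\<alpha> * norm (signed_sum S \<delta> B) \<le> 8 * C * \<Delta> * (8 * C) * (2 * C) * norm x"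
      by simp
  qed
qed

end

text \<open>The smallest coefficient on \<open>A\<close> is split off. A greedy set of order
  \<open>card A\<close> has all its coefficients at least that large, so \<open>le\<close> bounds
  the smallest one by \<open>K / \<eta> (card A)\<close>.\<close>

lemma sum_coef_le:
  assumes ex: "\<And>N. \<exists>A. greedy_set S N x A"
    and le: "\<And>A N \<alpha>. greedy_set S N x A \<Longrightarrow> 0 < \<alpha> \<Longrightarrow> (\<And>n. n \<in> A \<Longrightarrow> \<alpha> \<le> norm (coef S n x)) \<Longrightarrow>
      \<alpha> * \<eta> N \<le> K"
    and \<eta>: "\<And>j. 0 < \<eta> (Suc j)" and "0 \<le> K" and "finite A"
  shows "(\<Sum>n\<in>A. norm (coef S n x)) \<le> K * (\<Sum>j<card A. 1 / \<eta> (Suc j))"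
  using \<open>finite A\<close>
proof (induction "card A" arbitrary: A)
  case 0
  then show ?case by simp
next
  case (Suc N)
  then have ne: "A \<noteq> {}" by auto
  define \<alpha> where "\<alpha> = Min ((\<lambda>n. norm (coef S n x)) ` A)"
  have "\<alpha> \<in> (\<lambda>n. norm (coef S n x)) ` A"
    unfolding \<alpha>_def using ne Suc.prems by (intro Min_in) auto
  then obtain k where k: "k \<in> A" "norm (coef S k x) = \<alpha>" by auto
  have min: "\<alpha> \<le> norm (coef S n x)" if "n \<in> A" for n
    unfolding \<alpha>_def using that Suc.prems by simp
  obtain G where G: "greedy_set S (Suc N) x G"
    using ex by blast
  have minG: "\<alpha> \<le> norm (coef S n x)" if n: "n \<in> G" for n
  \<comment> \<open>Equal cardinality forces \<open>A = G\<close> in the first case; otherwise some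
    index of \<open>A\<close> lies outside \<open>G\<close> and is dominated by all of
    \<open>G\<close>.\<close>
  proof (cases "A \<subseteq> G")
    case True
    then have "A = G"
      using G Suc.hyps by (intro card_subset_eq) (auto simp: greedy_set_def)
    then show ?thesis using min n by simp
  next
    case False
    then obtain m where "m \<in> A" "m \<notin> G" by blast
    then show ?thesis
      using min[of m] G n by (auto simp: greedy_set_def intro: order_trans)
  qed
  have "\<alpha> \<le> K / \<eta> (Suc N)"
  proof (cases "\<alpha> = 0")
    case True
    then show ?thesis using \<eta>[of N] \<open>0 \<le> K\<close> by simp
  next
    case False
    then have "0 < \<alpha>" using k(2) by auto
    then show ?thesis
      using le[OF G _ minG] \<eta>[of N] by (simp add: pos_le_divide_eq)
  qed
  moreover have card: "card (A - {k}) = N"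
    using Suc.hyps k Suc.prems by simp
  moreover have "(\<Sum>n\<in>A - {k}. norm (coef S n x)) \<le> K * (\<Sum>j<card (A - {k}). 1 / \<eta> (Suc j))"
    using card Suc.prems by (intro Suc.hyps) auto
  moreover have "(\<Sum>n\<in>A. norm (coef S n x)) = \<alpha> + (\<Sum>n\<in>A - {k}. norm (coef S n x))"
    using k Suc.prems by (simp add: sum.remove)
  ultimately show ?case
    unfolding Suc.hyps(2)[symmetric] by (simp add: distrib_left)
qed

end

section \<open>The upper fundamental function as a real function\<close>

text \<open>The conversion sends infinite values to 0, so this agrees with \<open>D_up\<close> only
  once finiteness is known; bounded vectors ensure it.\<close>

definition upper_fundamental :: "('k::real_or_complex, 'a::real_normed_vector) bsystem \<Rightarrow> nat \<Rightarrow> real"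
  where "upper_fundamental S N = real_of_ereal (D_up S N)"

context biorthogonal_bsystem
begin

context
  fixes B :: real
  assumes vec_le: "\<And>n. norm (vec S n) \<le> B"
begin

lemma D_up_eq: "D_up S N = ereal (upper_fundamental S N)"
proof -
  have le: "v \<le> ereal (real N * B)" if v: "v \<in> signed_norms S N" for v
  proof -
    obtain \<epsilon> A where A: "v = ereal (norm (signed_sum S \<epsilon> A))" "finite A" "card A = N"
      "\<And>j. j \<in> A \<Longrightarrow> norm (\<epsilon> j) = 1"
      using v by (auto simp: signed_norms_def)
    have "norm (signed_sum S \<epsilon> A) \<le> (\<Sum>j\<in>A. B)"
      unfolding signed_sum_def using A(4) vec_le by (intro sum_norm_le) (simp add: norm_scal)
    then show ?thesis using A by simp
  qed
  have "ereal (norm (signed_sum S (\<lambda>_. 1) {..<N})) \<in> signed_norms S N"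
    unfolding signed_norms_def by force
  then have "ereal (norm (signed_sum S (\<lambda>_. 1) {..<N})) \<le> D_up S N"
    unfolding D_up_def by (rule Sup_upper)
  moreover have "D_up S N \<le> ereal (real N * B)"
    unfolding D_up_def by (rule Sup_least) (rule le)
  ultimately show ?thesis
    unfolding upper_fundamental_def by (cases "D_up S N") auto
qed

lemma signed_sum_le_upper_fundamental:
  assumes "finite A" "\<And>j. j \<in> A \<Longrightarrow> norm (\<epsilon> j) = 1"
  shows "norm (signed_sum S \<epsilon> A) \<le> upper_fundamental S (card A)"
proof -
  have "ereal (norm (signed_sum S \<epsilon> A)) \<le> D_up S (card A)"
    unfolding D_up_def using assms by (intro Sup_upper) (auto simp: signed_norms_def)
  then show ?thesis by (simp add: D_up_eq)
qed

lemma upper_fundamental_le: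
  assumes "\<And>A \<epsilon>. finite A \<Longrightarrow> card A = N \<Longrightarrow> (\<And>j. j \<in> A \<Longrightarrow> norm (\<epsilon> j) = 1) \<Longrightarrow>
    norm (signed_sum S \<epsilon> A) \<le> c"
  shows "upper_fundamental S N \<le> c"
proof -
  have "D_up S N \<le> ereal c"
    unfolding D_up_def using assms by (intro Sup_least) (auto simp: signed_norms_def)
  then show ?thesis by (simp add: D_up_eq)
qed

text \<open>Monotonicity: a signed sum is the average of its two extensions by a new vector with
  signs 1 and -1. Decreasing ratios: adding up the sums with one index deleted counts every vector
  of the full sum once less than its cardinality.\<close>

lemma fundamental_upper_fundamental: "fundamental (upper_fundamental S)"
  unfolding fundamental_def
proof (intro conjI allI impI)
  have "upper_fundamental S 0 \<le> 0"
    by (rule upper_fundamental_le) (simp add: signed_sum_def)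
  then show "upper_fundamental S 0 = 0"
    using signed_sum_le_upper_fundamental[of "{}" "\<lambda>_. 1"] by (simp add: signed_sum_def)
  show "mono (upper_fundamental S)"
    unfolding mono_iff_le_Suc
  proof (intro allI upper_fundamental_le)
    fix N A and \<epsilon> :: "nat \<Rightarrow> 'k"
    assume A: "finite A" "card A = N" "\<And>j. j \<in> A \<Longrightarrow> norm (\<epsilon> j) = 1"
    obtain k where k: "k \<notin> A"
      using A(1) ex_new_if_finite infinite_UNIV_nat by blast
    have sum_upd: "signed_sum S (\<epsilon>(k := t)) (insert k A) = scl S t (vec S k) + signed_sum S \<epsilon> A" for t
      unfolding signed_sum_def using A(1) k by (auto intro!: sum.cong)
    have le: "norm (signed_sum S (\<epsilon>(k := t)) (insert k A)) \<le> upper_fundamental S (Suc N)"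
      if "norm t = 1" for t
    proof -
      have "norm ((\<epsilon>(k := t)) j) = 1" if "j \<in> insert k A" for j
        using A(3) that \<open>norm t = 1\<close> by auto
      from signed_sum_le_upper_fundamental[of "insert k A" "\<epsilon>(k := t)", OF _ this] show ?thesis
        using A(1,2) k by simp
    qed
    have "2 *\<^sub>R signed_sum S \<epsilon> A =
        signed_sum S (\<epsilon>(k := 1)) (insert k A) + signed_sum S (\<epsilon>(k := - 1)) (insert k A)"
      unfolding sum_upd by (simp add: scaleR_2)
    then have "norm (2 *\<^sub>R signed_sum S \<epsilon> A) \<le> upper_fundamental S (Suc N) + upper_fundamental S (Suc N)"
      using le[of 1] le[of "- 1"] by (metis add_mono norm_minus_cancel norm_one norm_triangle_le)
    then show "norm (signed_sum S \<epsilon> A) \<le> upper_fundamental S (Suc N)"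
      by simp
  qed
  have step: "upper_fundamental S (Suc (Suc n)) / real (Suc (Suc n)) \<le>
      upper_fundamental S (Suc n) / real (Suc n)" for n
  proof -
    have "upper_fundamental S (Suc (Suc n)) \<le>
        real (Suc (Suc n)) * upper_fundamental S (Suc n) / real (Suc n)"
    proof (rule upper_fundamental_le)
      fix A and \<epsilon> :: "nat \<Rightarrow> 'k"
      assume A: "finite A" "card A = Suc (Suc n)" "\<And>j. j \<in> A \<Longrightarrow> norm (\<epsilon> j) = 1"
      let ?s = "signed_sum S \<epsilon> A"
      have "signed_sum S \<epsilon> (A - {k}) = ?s - scl S (\<epsilon> k) (vec S k)" if "k \<in> A" for k
        unfolding signed_sum_def using A(1) that by (simp add: sum_diff1)
      then have "(\<Sum>k\<in>A. signed_sum S \<epsilon> (A - {k})) = (\<Sum>k\<in>A. ?s) - ?s"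
        by (simp add: sum_subtractf signed_sum_def[of S \<epsilon> A])
      also have "\<dots> = real (Suc n) *\<^sub>R ?s"
      proof -
        have "(\<Sum>k\<in>A. ?s) = (1 + real (Suc n)) *\<^sub>R ?s"
          unfolding sum_constant_scaleR A(2) by simp
        then show ?thesis
          by (simp only: scaleR_add_left scaleR_one) simp
      qed
      finally have "real (Suc n) * norm ?s = norm (\<Sum>k\<in>A. signed_sum S \<epsilon> (A - {k}))"
        by simp
      also have "\<dots> \<le> (\<Sum>k\<in>A. upper_fundamental S (Suc n))"
      proof (rule sum_norm_le)
        fix k assume "k \<in> A"
        then show "norm (signed_sum S \<epsilon> (A - {k})) \<le> upper_fundamental S (Suc n)"
          using signed_sum_le_upper_fundamental[of "A - {k}" \<epsilon>] A by simp
      qed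
      also have "\<dots> = real (Suc (Suc n)) * upper_fundamental S (Suc n)"
        using A(2) by simp
      finally show "norm ?s \<le> real (Suc (Suc n)) * upper_fundamental S (Suc n) / real (Suc n)"
        by (simp add: field_simps)
    qed
    then show ?thesis
      by (simp add: field_simps)
  qed
  show "upper_fundamental S (Suc j) / real (Suc j) \<le> upper_fundamental S (Suc i) / real (Suc i)"
    if "i \<le> j" for i j
    using lift_Suc_antimono_le[of "\<lambda>n. upper_fundamental S (Suc n) / real (Suc n)", OF step that] .
qed

end

end

context bounded_bsystem
begin

lemma pos_fundamental:
  assumes "1 \<le> n"
  shows "0 < \<eta> n" "0 < \<theta> n"
proof -
  have "0 < \<eta> 1 * \<theta> 1"
    using one_le by linarith
  then have "0 < \<eta> 1" "0 < \<theta> 1"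
    using fundamentalD(3)[OF fund(1), of 1] fundamentalD(3)[OF fund(2), of 1]
    by (auto simp: zero_less_mult_iff)
  then show "0 < \<eta> n" "0 < \<theta> n"
    using fundamentalD(2)[OF fund(1) assms] fundamentalD(2)[OF fund(2) assms] by linarith+
qed

text \<open>A signed sum over \<open>n\<close> indices has coefficients of total size
  \<open>n\<close>, so its norm is at least \<open>n / \<theta> n\<close>. Hence the democracy ratio
  is at most \<open>\<eta> n * \<theta> n / n\<close>.\<close>

lemma mu_le:
  assumes D: "\<And>n. D_up S n = ereal (\<eta> n)"
  shows "mu S N \<le> ereal (tmin N)"
  unfolding mu_def
proof (rule SUP_least)
  fix n assume "n \<in> {1..N}"
  then have n: "1 \<le> n" "0 < n" "n \<le> N" by auto
  have "ereal (real n / \<theta> n) \<le> v" if v: "v \<in> signed_norms S n" for v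
  proof -
    obtain \<epsilon> A where A: "v = ereal (norm (signed_sum S \<epsilon> A))" "finite A" "card A = n"
      "\<And>j. j \<in> A \<Longrightarrow> norm (\<epsilon> j) = 1"
      using v by (auto simp: signed_norms_def)
    have "(\<Sum>j\<in>A. norm (coef S j (signed_sum S \<epsilon> A))) = (\<Sum>j\<in>A. 1)"
      using A by (intro sum.cong) (auto simp: signed_sum_def coef_combination)
    moreover have "signed_sum S \<epsilon> A \<in> Y"
      unfolding signed_sum_def by (rule combination_in_Y)
    ultimately have "real n \<le> \<theta> n * norm (signed_sum S \<epsilon> A)"
      using coef_le[OF A(2), of "signed_sum S \<epsilon> A"] A(3) by simp
    then show ?thesis
      using pos_fundamental(2)[OF n(1)] A(1) by (simp add: field_simps)
  qed
  then have low: "ereal (real n / \<theta> n) \<le> d_low S n"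
    unfolding d_low_def by (rule Inf_greatest)
  have "D_up S n / d_low S n \<le> ereal (\<eta> n * \<theta> n / real n)"
  proof (cases "d_low S n")
    case (real r)
    then have r: "real n / \<theta> n \<le> r"
      using low by simp
    have "0 < real n / \<theta> n"
      using n pos_fundamental(2)[OF n(1)] by simp
    then have "\<eta> n / r \<le> \<eta> n / (real n / \<theta> n)"
      using r pos_fundamental(1)[OF n(1)]
      by (intro divide_left_mono mult_pos_pos) (auto intro: less_le_trans)
    then show ?thesis
      using real r \<open>0 < real n / \<theta> n\<close> D by simp
  next
    case PInf
    then show ?thesis
      using D fundamentalD(3)[OF fund(1)] fundamentalD(3)[OF fund(2)] by simp
  next
    case MInf
    then show ?thesis using low by simp
  qed
  also have "\<dots> \<le> ereal (tmin N)"
    using product_ratio_le_tmin[OF n(2,3)] by simp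
  finally show "D_up S n / d_low S n \<le> ereal (tmin N)" .
qed

end

section \<open>The dual system and the first inequality\<close>

lemma T_sum_ereal:
  "\<theta> 0 = 0 \<Longrightarrow> T_sum (\<lambda>n. ereal (\<eta> n)) (\<lambda>n. ereal (\<theta> n)) N = ereal (tsum \<eta> \<theta> N)"
  unfolding T_sum_def tsum_def One_nat_def sum.atLeast1_atMost_eq
  by (subst sum_ereal[symmetric]) (intro sum.cong, auto simp del: of_nat_Suc)

text \<open>The easy inequality for the operator norm, applied also to the inverse scalar, gives
  homogeneity.\<close>

lemma scalar_normed_space_dual:
  "scalar_normed_space (dual_scal :: 'k::real_or_complex \<Rightarrow> ('a::real_normed_vector \<Rightarrow>\<^sub>L 'k) \<Rightarrow> _)"
proof
  fix c :: 'k and f :: "'a \<Rightarrow>\<^sub>L 'k" and r :: real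
  have le: "norm (dual_scal d g) \<le> norm d * norm g" for d :: 'k and g :: "'a \<Rightarrow>\<^sub>L 'k"
    by (rule norm_blinfun_bound) (auto simp: norm_mult mult.assoc intro!: mult_left_mono norm_blinfun)
  show "norm (dual_scal c f) = norm c * norm f"
  proof (cases "c = 0")
    case True
    then show ?thesis using le[of c f] by simp
  next
    case False
    have "dual_scal (inverse c) (dual_scal c f) = f"
      using False by (intro blinfun_eqI) simp
    then have "norm f \<le> norm (inverse c) * norm (dual_scal c f)"
      using le[of "inverse c" "dual_scal c f"] by simp
    then have "norm f \<le> inverse (norm c) * norm (dual_scal c f)"
      by (simp only: norm_inverse)
    then have "norm c * norm f \<le> norm (dual_scal c f)"
      using False by (simp add: field_simps)
    with le[of c f] show ?thesis by simp
  qed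
  show "dual_scal (of_real r) f = r *\<^sub>R f"
    by (rule blinfun_eqI) (simp add: blinfun.scaleR_left scaleR_conv_of_real)
qed (auto intro!: blinfun_eqI simp: blinfun.add_right blinfun.add_left algebra_simps)

lemma closed_dual_space: "closed (dual_space scal)"
proof -
  have "dual_space scal = (\<Inter>c. \<Inter>x. {f. blinfun_apply f (scal c x) = c * blinfun_apply f x})"
    by (auto simp: dual_space_def)
  then show ?thesis
    by (auto intro!: closed_INT closed_Collect_eq continuous_intros)
qed

lemma unimodular_times_eq_norm:
  fixes z :: "'b \<Rightarrow> 'k::real_normed_field"
  obtains \<epsilon> where "\<And>n. norm (\<epsilon> n) = 1" "\<And>n. \<epsilon> n * z n = of_real (norm (z n))"
  using that[of "\<lambda>n. if z n = 0 then 1 else of_real (norm (z n)) / z n"]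
  by (simp add: norm_divide)

locale bounded_biorthogonal_pair =
  fixes scal :: "'k::real_or_complex \<Rightarrow> 'a::real_normed_vector \<Rightarrow> 'a"
    and e :: "nat \<Rightarrow> 'a" and es :: "nat \<Rightarrow> 'a \<Rightarrow>\<^sub>L 'k" and B :: real
  assumes scal: "scalar_normed_space scal"
    and es_dual: "\<And>n. es n \<in> dual_space scal"
    and biorth: "biorthogonal e es"
    and e_le: "\<And>n. norm (e n) \<le> B" and es_le: "\<And>n. norm (es n) \<le> B"
begin

abbreviation "P \<equiv> primal_system scal e es"
abbreviation "Q \<equiv> dual_system e es"
abbreviation "\<phi> \<equiv> upper_fundamental P"
abbreviation "\<psi> \<equiv> upper_fundamental Q"

lemma P_simps [simp]: "spc P = UNIV" "scl P = scal" "vec P = e" "coef P n x = blinfun_apply (es n) x"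
  by (simp_all add: primal_system_def)

lemma Q_simps [simp]: "scl Q = dual_scal" "vec Q = es" "coef Q n f = blinfun_apply f (e n)"
  by (simp_all add: dual_system_def)

sublocale P: biorthogonal_bsystem P
  using scal es_dual biorth
  by (simp add: biorthogonal_bsystem_def biorthogonal_bsystem_axioms_def blinfun.add_right
      dual_space_def biorthogonal_def)

sublocale Q: biorthogonal_bsystem Q
  using biorth scalar_normed_space_dual
  by (simp add: biorthogonal_bsystem_def biorthogonal_bsystem_axioms_def blinfun.add_left
      biorthogonal_def eq_commute)

lemma signed_sum_Q_apply:
  "blinfun_apply (signed_sum Q \<epsilon> A) x = (\<Sum>n\<in>A. \<epsilon> n * blinfun_apply (es n) x)"
  by (simp add: signed_sum_def blinfun.sum_left)

lemma dual_apply_signed_sum_P: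
  "f \<in> dual_space scal \<Longrightarrow>
    blinfun_apply f (signed_sum P \<epsilon> A) = (\<Sum>n\<in>A. \<epsilon> n * blinfun_apply f (e n))"
  by (simp add: signed_sum_def blinfun.sum_right dual_space_def)

lemma fundamental_\<phi>_\<psi>: "fundamental \<phi>" "fundamental \<psi>"
  using P.fundamental_upper_fundamental[of B] Q.fundamental_upper_fundamental[of B] e_le es_le
  by auto

lemma one_le_\<phi>_\<psi>: "1 \<le> \<phi> 1 * \<psi> 1"
proof -
  have "norm (e 0) \<le> \<phi> 1"
    using P.signed_sum_le_upper_fundamental[of B "{0}" "\<lambda>_. 1"] e_le
    by (simp add: signed_sum_def P.scale_one[simplified])
  moreover have "norm (es 0) \<le> \<psi> 1"
    using Q.signed_sum_le_upper_fundamental[of B "{0}" "\<lambda>_. 1"] es_le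
    by (simp add: signed_sum_def Q.scale_one[simplified])
  moreover have "1 \<le> norm (es 0) * norm (e 0)"
    using norm_blinfun[of "es 0" "e 0"] biorth by (simp add: biorthogonal_def)
  ultimately show ?thesis
    by (smt (verit) mult.commute mult_mono norm_ge_zero)
qed

lemma dual_subspace: "Q.subspace (dual_space scal)"
  unfolding Q.subspace_def by (auto simp: dual_space_def blinfun.add_left algebra_simps)

lemma spc_Q_subset: "spc Q \<subseteq> dual_space scal"
proof -
  have "Q.span (range es) \<subseteq> dual_space scal"
    using es_dual dual_subspace by (intro Q.span_minimal) auto
  then show ?thesis
    using closure_minimal[OF _ closed_dual_space] by (simp add: dual_system_def)
qed

sublocale PB: bounded_bsystem P UNIV \<phi> \<psi>
proof
  show "P.subspace UNIV" by (rule P.subspace_UNIV)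
  show "norm (signed_sum P \<epsilon> A) \<le> \<phi> (card A)" if "finite A" "\<And>j. j \<in> A \<Longrightarrow> norm (\<epsilon> j) = 1" for A \<epsilon>
    using P.signed_sum_le_upper_fundamental[of B A \<epsilon>] e_le that by simp
  show "(\<Sum>n\<in>A. norm (coef P n x)) \<le> \<psi> (card A) * norm x" if A: "finite A" for A x
  proof -
    \<comment> \<open>Aligning the phases makes the coefficient sum a single value of a signed sum
      of the dual functionals.\<close>
    obtain \<epsilon> where \<epsilon>: "\<And>n. norm (\<epsilon> n) = 1"
      "\<And>n. \<epsilon> n * blinfun_apply (es n) x = of_real (norm (blinfun_apply (es n) x))"
      using unimodular_times_eq_norm[of "\<lambda>n. blinfun_apply (es n) x"] by blast
    have "(\<Sum>n\<in>A. norm (coef P n x)) = norm (blinfun_apply (signed_sum Q \<epsilon> A) x)"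
      unfolding signed_sum_Q_apply \<epsilon>(2) of_real_sum[symmetric] norm_of_real by (simp add: sum_nonneg)
    also have "\<dots> \<le> norm (signed_sum Q \<epsilon> A) * norm x"
      by (rule norm_blinfun)
    also have "\<dots> \<le> \<psi> (card A) * norm x"
      using Q.signed_sum_le_upper_fundamental[of B A \<epsilon>] es_le A \<epsilon>(1) by (intro mult_right_mono) auto
    finally show ?thesis .
  qed
qed (use fundamental_\<phi>_\<psi> one_le_\<phi>_\<psi> in auto)

text \<open>The coefficient bound tests \<open>f\<close> on a signed sum of the \<open>e n\<close>,
  which needs linearity over the full scalar field. Therefore \<open>Y\<close> is
  \<open>dual_space scal\<close> rather than all bounded real-linear maps.\<close>

sublocale QB: bounded_bsystem Q "dual_space scal" \<psi> \<phi>
proof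
  show "Q.subspace (dual_space scal)" by (rule dual_subspace)
  show "norm (signed_sum Q \<epsilon> A) \<le> \<psi> (card A)" if "finite A" "\<And>j. j \<in> A \<Longrightarrow> norm (\<epsilon> j) = 1" for A \<epsilon>
    using Q.signed_sum_le_upper_fundamental[of B A \<epsilon>] es_le that by simp
  show "(\<Sum>n\<in>A. norm (coef Q n f)) \<le> \<phi> (card A) * norm f"
    if A: "finite A" and f: "f \<in> dual_space scal" for A f
  proof -
    obtain \<epsilon> where \<epsilon>: "\<And>n. norm (\<epsilon> n) = 1"
      "\<And>n. \<epsilon> n * blinfun_apply f (e n) = of_real (norm (blinfun_apply f (e n)))"
      using unimodular_times_eq_norm[of "\<lambda>n. blinfun_apply f (e n)"] by blast
    have "(\<Sum>n\<in>A. norm (coef Q n f)) = norm (blinfun_apply f (signed_sum P \<epsilon> A))"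
      unfolding dual_apply_signed_sum_P[OF f] \<epsilon>(2) of_real_sum[symmetric] norm_of_real
      by (simp add: sum_nonneg)
    also have "\<dots> \<le> norm f * norm (signed_sum P \<epsilon> A)"
      by (rule norm_blinfun)
    also have "\<dots> \<le> norm f * \<phi> (card A)"
      using P.signed_sum_le_upper_fundamental[of B A \<epsilon>] e_le A \<epsilon>(1) by (intro mult_left_mono) auto
    finally show ?thesis by (simp add: mult.commute)
  qed
qed (use fundamental_\<phi>_\<psi> one_le_\<phi>_\<psi> spc_Q_subset es_dual in \<open>auto simp: mult.commute\<close>)

lemma D_up_P: "D_up P n = ereal (\<phi> n)" and D_up_Q: "D_up Q n = ereal (\<psi> n)"
  using P.D_up_eq[of B n] Q.D_up_eq[of B n] e_le es_le by auto

lemma T_bar_eq: "T_bar (D_up P) (D_up Q) N = ereal (PB.tmin N)"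
proof -
  have "D_up P = (\<lambda>n. ereal (\<phi> n))" "D_up Q = (\<lambda>n. ereal (\<psi> n))"
    using D_up_P D_up_Q by auto
  then show ?thesis
    using fundamentalD(1)[OF fundamental_\<phi>_\<psi>(1)] fundamentalD(1)[OF fundamental_\<phi>_\<psi>(2)]
    by (simp add: T_bar_def T_sum_ereal PB.tmin_def)
qed

lemma parameters_lesssim:
  "(\<lambda>N. Max {K_par P N, Leb_tilde P N, Leb P N, g_par Q N, mu Q N, Leb_tilde Q N, Leb Q N})
    \<lesssim> T_bar (D_up P) (D_up Q)"
  unfolding lesssim_def
proof (intro exI[of _ 4] conjI allI impI)
  fix N :: nat assume N: "1 \<le> N"
  have tmin: "QB.tmin N = PB.tmin N"
    by (simp add: QB.tmin_def PB.tmin_def min.commute)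
  have le4: "v \<le> ereal (4 * PB.tmin N)" if "v \<le> ereal (PB.tmin N)" for v
    using that PB.one_le_tmin[OF N] by (elim order_trans) simp
  show "Max {K_par P N, Leb_tilde P N, Leb P N, g_par Q N, mu Q N, Leb_tilde Q N, Leb Q N}
      \<le> ereal 4 * T_bar (D_up P) (D_up Q) N"
    using PB.Leb_le[OF N] PB.Leb_tilde_le[OF N] QB.Leb_le[OF N] QB.Leb_tilde_le[OF N]
      le4[OF PB.K_par_le] le4[OF QB.g_par_le[of N, unfolded tmin]]
      le4[OF QB.mu_le[of N, OF D_up_Q, unfolded tmin]]
    by (simp add: T_bar_eq tmin)
qed simp

section \<open>The logarithmic bound\<close>

text \<open>By completeness \<open>x\<close> is close to a finite combination \<open>y\<close>, and
  outside the support of \<open>y\<close> the coefficients of \<open>x\<close> are those of the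
  small vector \<open>x - y\<close>.\<close>

lemma finite_large_coefs:
  assumes "complete_system scal e" "0 < \<delta>"
  shows "finite {n. \<delta> \<le> norm (blinfun_apply (es n) x)}"
proof -
  have "0 \<le> B"
    using e_le[of 0] norm_ge_zero order_trans by blast
  define \<rho> where "\<rho> = \<delta> / (B + 1)"
  have \<rho>: "0 < \<rho>" "B * \<rho> < \<delta>"
    using assms(2) \<open>0 \<le> B\<close> by (auto simp: \<rho>_def field_simps)
  have "x \<in> closure (P.span (range e))"
    using assms(1) by (simp add: complete_system_def)
  then obtain y where y: "y \<in> P.span (range e)" "dist y x < \<rho>"
    using \<rho>(1) closure_approachable by blast
  have "P.subspace {y. finite {n. blinfun_apply (es n) y \<noteq> 0}}"
  proof (rule P.subspaceI)
    fix u v assume "u \<in> {y. finite {n. blinfun_apply (es n) y \<noteq> 0}}"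
      "v \<in> {y. finite {n. blinfun_apply (es n) y \<noteq> 0}}"
    then have "finite ({n. blinfun_apply (es n) u \<noteq> 0} \<union> {n. blinfun_apply (es n) v \<noteq> 0})"
      by simp
    then show "u + v \<in> {y. finite {n. blinfun_apply (es n) y \<noteq> 0}}"
      by (simp, elim finite_subset[rotated]) (auto simp: blinfun.add_right)
  next
    fix c u assume "u \<in> {y. finite {n. blinfun_apply (es n) y \<noteq> 0}}"
    then show "scl P c u \<in> {y. finite {n. blinfun_apply (es n) y \<noteq> 0}}"
      using es_dual by (simp add: dual_space_def)
  qed simp
  moreover have "range e \<subseteq> {y. finite {n. blinfun_apply (es n) y \<noteq> 0}}"
    using biorth by (auto simp: biorthogonal_def)
  ultimately have "finite {n. blinfun_apply (es n) y \<noteq> 0}"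
    using y(1) P.span_minimal by blast
  moreover have "blinfun_apply (es n) y \<noteq> 0" if "\<delta> \<le> norm (blinfun_apply (es n) x)" for n
  proof
    assume "blinfun_apply (es n) y = 0"
    then have "norm (blinfun_apply (es n) x) = norm (blinfun_apply (es n) (x - y))"
      by (simp add: blinfun.diff_right)
    also have "\<dots> \<le> norm (es n) * norm (x - y)"
      by (rule norm_blinfun)
    also have "\<dots> \<le> B * \<rho>"
      using y(2) es_le \<open>0 \<le> B\<close> by (intro mult_mono) (auto simp: dist_norm norm_minus_commute)
    finally show False using that \<rho>(2) by simp
  qed
  ultimately show ?thesis
    by (elim finite_subset[rotated]) auto
qed

text \<open>At a vector \<open>x\<close>, a signed sum of dual functionals is at most the
  coefficient sum of \<open>x\<close> over the same set, which \<open>sum_coef_le\<close> bounds by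
  \<open>norm x\<close> times the sum of reciprocals.\<close>

lemma \<psi>_le_of_almost_greedy:
  assumes "complete_system scal e" "almost_greedy P"
  obtains C where "0 \<le> C" "\<And>n. \<psi> n \<le> C * (\<Sum>j<n. 1 / \<phi> (Suc j))"
proof -
  have ex: "\<exists>A. greedy_set P N x A" for x N
    using finite_large_coefs[OF assms(1)] by (intro P.ex_greedy_set) simp
  obtain C where C: "0 \<le> C" "\<And>x A N. greedy_set P N x A \<Longrightarrow> norm (proj P A x) \<le> C * norm x"
    using P.greedy_projections_bounded[OF _ ex] assms(2) by (auto simp: almost_greedy_def)
  have dem: "democratic P"
    using assms(2) by (simp add: almost_greedy_def)
  obtain M where M: "0 \<le> M"
    "\<And>x A N \<alpha> B \<delta>. greedy_set P N x A \<Longrightarrow> 0 < \<alpha> \<Longrightarrow> (\<And>n. n \<in> A \<Longrightarrow> \<alpha> \<le> norm (coef P n x)) \<Longrightarrow>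
      finite B \<Longrightarrow> card B = N \<Longrightarrow> (\<And>n. n \<in> B \<Longrightarrow> norm (\<delta> n) = 1) \<Longrightarrow>
      \<alpha> * norm (signed_sum P \<delta> B) \<le> M * norm x"
    by (rule P.min_coef_times_signed_sum_le[OF C(2) C(1) dem]) (assumption, erule that, blast)
  have M': "\<alpha> * \<phi> N \<le> M * norm x"
    if "greedy_set P N x A" "0 < \<alpha>" "\<And>n. n \<in> A \<Longrightarrow> \<alpha> \<le> norm (coef P n x)" for x A N \<alpha>
  proof -
    have "\<phi> N \<le> M * norm x / \<alpha>"
    proof (rule P.upper_fundamental_le[of B])
      fix F and \<delta> :: "nat \<Rightarrow> 'k"
      assume "finite F" "card F = N" "\<And>j. j \<in> F \<Longrightarrow> norm (\<delta> j) = 1"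
      then show "norm (signed_sum P \<delta> F) \<le> M * norm x / \<alpha>"
        using M(2)[OF that, of F \<delta>] that(2) by (simp add: field_simps)
    qed (use e_le in simp)
    then show ?thesis
      using that(2) by (simp add: field_simps)
  qed
  have "\<psi> n \<le> M * (\<Sum>j<n. 1 / \<phi> (Suc j))" for n
  proof (rule Q.upper_fundamental_le[of B])
    fix A and \<epsilon> :: "nat \<Rightarrow> 'k"
    assume A: "finite A" "card A = n" "\<And>j. j \<in> A \<Longrightarrow> norm (\<epsilon> j) = 1"
    show "norm (signed_sum Q \<epsilon> A) \<le> M * (\<Sum>j<n. 1 / \<phi> (Suc j))"
    proof (rule norm_blinfun_bound)
      show "0 \<le> M * (\<Sum>j<n. 1 / \<phi> (Suc j))"
        using M(1) PB.pos_fundamental(1) by (intro mult_nonneg_nonneg sum_nonneg) (auto simp: less_imp_le)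
      fix x
      have "norm (blinfun_apply (signed_sum Q \<epsilon> A) x) \<le> (\<Sum>j\<in>A. norm (coef P j x))"
        unfolding signed_sum_Q_apply using A(3) by (intro sum_norm_le) (simp add: norm_mult)
      also have "\<dots> \<le> (M * norm x) * (\<Sum>j<card A. 1 / \<phi> (Suc j))"
        using ex M' M(1) PB.pos_fundamental(1) A(1) by (intro P.sum_coef_le) auto
      finally show "norm (blinfun_apply (signed_sum Q \<epsilon> A) x) \<le> M * (\<Sum>j<n. 1 / \<phi> (Suc j)) * norm x"
        using A(2) by (simp add: mult_ac)
    qed
  qed (use es_le in simp)
  with M(1) show thesis by (rule that)
qed

text \<open>Bidemocracy gives \<open>c * n / \<phi> n\<close>, and since \<open>\<phi>\<close>
  increases, each of the \<open>n\<close> reciprocals is at least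
  \<open>1 / \<phi> n\<close>.\<close>

lemma \<psi>_le_of_bidemocratic:
  assumes "bidemocratic P Q"
  obtains C where "0 \<le> C" "\<And>n. \<psi> n \<le> C * (\<Sum>j<n. 1 / \<phi> (Suc j))"
proof -
  obtain c where c: "\<And>n. 1 \<le> n \<Longrightarrow> \<phi> n * \<psi> n \<le> c * real n"
    using assms by (auto simp: bidemocratic_def D_up_P D_up_Q)
  have "0 \<le> c"
    using c[of 1] one_le_\<phi>_\<psi> by simp
  moreover have "\<psi> n \<le> c * (\<Sum>j<n. 1 / \<phi> (Suc j))" for n
  proof (cases "n = 0")
    case True
    then show ?thesis using fundamentalD(1)[OF fundamental_\<phi>_\<psi>(2)] by simp
  next
    case False
    then have pos: "0 < \<phi> n"
      using PB.pos_fundamental(1) by simp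
    have "\<psi> n \<le> c * (\<Sum>j<n. 1 / \<phi> n)"
      using c[of n] False pos by (simp add: field_simps)
    also have "\<dots> \<le> c * (\<Sum>j<n. 1 / \<phi> (Suc j))"
      using \<open>0 \<le> c\<close> PB.pos_fundamental(1) pos fundamentalD(2)[OF fundamental_\<phi>_\<psi>(1)]
      by (intro mult_left_mono sum_mono divide_left_mono) auto
    finally show ?thesis .
  qed
  ultimately show thesis by (rule that)
qed

lemma T_bar_lesssim_ln:
  assumes "complete_system scal e" "almost_greedy P \<or> bidemocratic P Q"
  shows "T_bar (D_up P) (D_up Q) \<lesssim> (\<lambda>N. ereal (ln (real N + 1)))"
proof -
  obtain C where C: "0 \<le> C" "\<And>n. \<psi> n \<le> C * (\<Sum>j<n. 1 / \<phi> (Suc j))"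
    using assms(2) \<psi>_le_of_almost_greedy[OF assms(1)] \<psi>_le_of_bidemocratic by metis
  \<comment> \<open>\<open>C\<close> may be 0, while \<open>lesssim\<close> asks for a positive
    constant; hence the added 1.\<close>
  have "PB.tmin N \<le> (2 * C + 1) * ln (real N + 1)" for N
  proof -
    have "PB.tmin N \<le> tsum \<phi> \<psi> N"
      by (simp add: PB.tmin_def)
    also have "\<dots> \<le> 2 * C * ln (real N + 1)"
      using C PB.pos_fundamental(1) by (intro tsum_le_ln fundamental_\<phi>_\<psi>) auto
    also have "\<dots> \<le> (2 * C + 1) * ln (real N + 1)"
      by (intro mult_right_mono) auto
    finally show ?thesis .
  qed
  then show ?thesis
    unfolding lesssim_def T_bar_eq using C(1) by (intro exI[of _ "2 * C + 1"]) auto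
qed

end

theorem corollary7p6:
  fixes scal :: "'k::real_or_complex \<Rightarrow> 'a::banach \<Rightarrow> 'a"
    and e :: "nat \<Rightarrow> 'a"
    and es :: "nat \<Rightarrow> 'a \<Rightarrow>\<^sub>L 'k"
  assumes "scalar_normed_space scal"
    and "separable_space (euclidean :: 'a topology)"
    and "infinite_dimensional scal"
    and "\<And>n. es n \<in> dual_space scal"
    and "biorthogonal e es"
    and "seminormalized e es"
    and "complete_system scal e"
    and "almost_greedy (primal_system scal e es) \<or>
         bidemocratic (primal_system scal e es) (dual_system e es)"
  shows "(\<lambda>N. Max {K_par (primal_system scal e es) N,
                   Leb_tilde (primal_system scal e es) N,
                   Leb (primal_system scal e es) N,
                   g_par (dual_system e es) N,
                   mu (dual_system e es) N,
                   Leb_tilde (dual_system e es) N,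
                   Leb (dual_system e es) N})
           \<lesssim> T_bar (D_up (primal_system scal e es)) (D_up (dual_system e es))
       \<and> T_bar (D_up (primal_system scal e es)) (D_up (dual_system e es))
           \<lesssim> (\<lambda>N. ereal (ln (real N + 1)))"
proof -
  obtain B where B: "\<And>n. norm (e n) \<le> B" "\<And>n. norm (es n) \<le> B"
    using assms(6) unfolding seminormalized_def by blast
  interpret bounded_biorthogonal_pair scal e es B
    using assms(1,4,5) B by (intro bounded_biorthogonal_pair.intro)
  show ?thesis
    using parameters_lesssim T_bar_lesssim_ln assms by blast
qed

end
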